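(* Let $\mathbb{K}$ be a field, $S=\mathbb{K}[x_1,\ldots,x_n]$, and let $m=x_{i_1}x_{i_2}\cdots x_{i_s}\in S$ be a square-free monomial with $1\le i_1<i_2<\cdots<i_s\le n$. Let $T(m)=(t_k,\ldots,t_0)$ and suppose that $i_{t_k}<s$. Let $T'(m)=(t_{k_r},\ldots,t_{k_1})$, let $l$ be the largest index in $\{0,\ldots,k\}$ such that $i_{t_{k_1}}+1\leq t_l$, and let $I=\mathrm{sfBorel}(m)$. Then $$\widehat{\alpha}(I)\geq 1+\frac{s-i_{t_{k_1}}-1}{i_{t_l}-t_l+1}+\frac{i_{t_k}}{i_{t_{k}}-t_k+1}+\sum_{j=1}^{r-1}\frac{i_{t_{k_j}}-i_{t_{k_{j+1}}}}{i_{t_{k_j}}-t_{k_{j}}+1}.$$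
   Context: Square-free principal Borel ideal. For a monomial $m$, a Borel move of $m$ is a monomial $m\cdot\frac{x_{a_1}}{x_{b_1}}\cdots\frac{x_{a_q}}{x_{b_q}}$ with $a_p<b_p$ and $x_{b_p}\mid m$ for all $p$ (the trivial move giving $m$ itself is allowed). For a square-free monomial $m$, $\mathrm{sfBorel}(m)$ is the ideal of $S$ generated by all square-free monomials that are Borel moves of $m$; equivalently, for $m=x_{i_1}\cdots x_{i_s}$ with $i_1<\cdots<i_s$, it is generated by all $x_{j_1}\cdots x_{j_s}$ with $j_1<\cdots<j_s$ and $j_p\le i_p$ for all $p$. Waldschmidt constant. For a square-free monomial ideal $L\subseteq S$ with minimal primary decomposition $L=P_1\cap\cdots\cap P_t$ (the $P_i$ prime), the $q$-th symbolic power is $L^{(q)}=P_1^q\cap\cdots\cap P_t^q$. Write $\alpha(J)$ for the smallest degree of a generator of a homogeneous ideal $J$. Then $\widehat{\alpha}(L)=\lim_{q\to\infty}\alpha(L^{(q)})/q$. The tuple $T(m)$. For $m=x_{i_1}\cdots x_{i_s}$ with $i_1<\cdots<i_s$, put $t_0=s$ and, once $t_{q-1}$ is defined, put $t_q=\max\{j: 1\le j<t_{q-1},\ i_j<i_{j+1}-1\}$, stopping when this set is empty; the last one defined is $t_k$. Write $T(m)=(t_k,\ldots,t_0)$, so $t_k<t_{k-1}<\cdots<t_0=s$. The subsequence $T'(m)$ (defined when $i_{t_k}<s$). Define elements $t_1'<t_2'<\cdots<t_r'$ of $T(m)$ inductively: $t_1'=t_k$; given $t_j'$, let $t_{j+1}'$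 be the smallest element $t$ of $T(m)$ such that $i_{t_j'}<t$ and $i_t\le s-1$, stopping if there is none. So $i_{t_j'}\le s-1$ for all $1\le j\le r$. One writes $T'(m)=(t_{k_r},\ldots,t_{k_1})$ where $t_{k_j}=t'_{r-j+1}$; thus $t_{k_r}=t_k$ and $t_{k_r}<\cdots<t_{k_1}$. Since $i_{t_{k_1}}+1\le s=t_0$, an index $l$ with $i_{t_{k_1}}+1\le t_l$ exists. *)

theory Defs
  imports Complex_Main "HOL-Library.Poly_Mapping" "HOL-Algebra.Ideal_Product"
begin

section \<open>The polynomial ring in finitely many variables\<close>

text \<open>
  A monomial is its exponent vector, written additively: the product of two monomials is the
  sum of their exponent vectors, and the variable with index \<open>v\<close> is \<open>Poly_Mapping.single v 1\<close>.
  The multiplication on the type below is convolution, i.e. multiplication of polynomials.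
\<close>

type_synonym monom = "nat \<Rightarrow>\<^sub>0 nat"

type_synonym 'a mpoly = "monom \<Rightarrow>\<^sub>0 'a"

definition poly_ring :: "nat \<Rightarrow> ('a::field) mpoly ring" where
  "poly_ring n =
     \<lparr> carrier = {p. \<forall>u\<in>Poly_Mapping.keys p. Poly_Mapping.keys u \<subseteq> {1..n}},
       mult = (*), one = 1, zero = 0, add = (+) \<rparr>"

definition monom_poly :: "monom \<Rightarrow> ('a::field) mpoly" where
  "monom_poly u = Poly_Mapping.single u 1"

definition monom_degree :: "monom \<Rightarrow> nat" where
  "monom_degree u = (\<Sum>v\<in>Poly_Mapping.keys u. Poly_Mapping.lookup u v)"

definition homogeneous_of_degree :: "nat \<Rightarrow> ('a::field) mpoly \<Rightarrow> bool" where
  "homogeneous_of_degree d p \<longleftrightarrow> (\<forall>u\<in>Poly_Mapping.keys p. monom_degree u = d)"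

definition squarefree_monom :: "monom \<Rightarrow> bool" where
  "squarefree_monom u \<longleftrightarrow> (\<forall>v. Poly_Mapping.lookup u v \<le> 1)"


section \<open>Square-free principal Borel ideals\<close>

text \<open>
  The list \<open>ps\<close> holds the pairs $(a_p, b_p)$; denominators are cleared, so the equation says
  $u \cdot \prod_p x_{b_p} = m \cdot \prod_p x_{a_p}$. The empty list is the trivial move.
\<close>

definition borel_move :: "monom \<Rightarrow> monom \<Rightarrow> bool" where
  "borel_move m u \<longleftrightarrow>
     (\<exists>ps. (\<forall>(a, b)\<in>set ps. 1 \<le> a \<and> a < b \<and> b \<in> Poly_Mapping.keys m) \<and>
           u + (\<Sum>(a, b)\<leftarrow>ps. Poly_Mapping.single b 1) =
           m + (\<Sum>(a, b)\<leftarrow>ps. Poly_Mapping.single a 1))"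

definition sfBorel :: "nat \<Rightarrow> monom \<Rightarrow> ('a::field) mpoly set" where
  "sfBorel n m = Idl\<^bsub>poly_ring n\<^esub> (monom_poly ` {u. squarefree_monom u \<and> borel_move m u})"


section \<open>Symbolic powers and the Waldschmidt constant\<close>

definition primary_ideal :: "('b, 'c) ring_scheme \<Rightarrow> 'b set \<Rightarrow> bool" where
  "primary_ideal R Q \<longleftrightarrow>
     ideal Q R \<and> Q \<noteq> carrier R \<and>
     (\<forall>a\<in>carrier R. \<forall>b\<in>carrier R.
        a \<otimes>\<^bsub>R\<^esub> b \<in> Q \<longrightarrow> a \<in> Q \<or> (\<exists>k::nat. b [^]\<^bsub>R\<^esub> k \<in> Q))"

definition radical :: "('b, 'c) ring_scheme \<Rightarrow> 'b set \<Rightarrow> 'b set" where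
  "radical R Q = {a \<in> carrier R. \<exists>k::nat. a [^]\<^bsub>R\<^esub> k \<in> Q}"

text \<open>
  Intersections are taken inside the ring, so that the empty intersection is the unit ideal.
\<close>

definition minimal_primary_decomposition ::
    "('b, 'c) ring_scheme \<Rightarrow> 'b set \<Rightarrow> 'b set set \<Rightarrow> bool" where
  "minimal_primary_decomposition R L Qs \<longleftrightarrow>
     finite Qs \<and> (\<forall>Q\<in>Qs. primary_ideal R Q) \<and>
     L = carrier R \<inter> \<Inter>Qs \<and>
     inj_on (radical R) Qs \<and>
     (\<forall>Q\<in>Qs. \<not> carrier R \<inter> \<Inter>(Qs - {Q}) \<subseteq> Q)"

text \<open>
  Meant for ideals, such as square-free monomial ideals, that have a minimal primary
  decomposition all of whose components are prime; this decomposition is then unique.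
  The power of a component is taken in the semiring of ideals of \<open>R\<close>.
\<close>

definition prime_components :: "('b, 'c) ring_scheme \<Rightarrow> 'b set \<Rightarrow> 'b set set" where
  "prime_components R L =
     (THE Ps. minimal_primary_decomposition R L Ps \<and> (\<forall>P\<in>Ps. primeideal P R))"

definition symbolic_power :: "('b, 'c) ring_scheme \<Rightarrow> 'b set \<Rightarrow> nat \<Rightarrow> 'b set" where
  "symbolic_power R L q =
     carrier R \<inter> (\<Inter>P\<in>prime_components R L. P [^]\<^bsub>ideals_set R\<^esub> q)"

text \<open>
  The smallest degree of an element of a homogeneous generating set of \<open>J\<close>. It does not depend
  on the generating set, so minimising over all of them is harmless.
\<close>

definition alpha :: "nat \<Rightarrow> ('a::field) mpoly set \<Rightarrow> nat" where
  "alpha n J =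
     (LEAST d. \<exists>G \<subseteq> carrier (poly_ring n).
        (\<forall>g\<in>G. g \<noteq> 0 \<and> (\<exists>e. homogeneous_of_degree e g)) \<and>
        Idl\<^bsub>poly_ring n\<^esub> G = J \<and>
        (\<exists>g\<in>G. homogeneous_of_degree d g))"

definition waldschmidt :: "nat \<Rightarrow> ('a::field) mpoly set \<Rightarrow> real" where
  "waldschmidt n L = lim (\<lambda>q. real (alpha n (symbolic_power (poly_ring n) L q)) / real q)"


section \<open>The tuples T(m) and T'(m)\<close>

text \<open>
  The monomial is given by its indices $i_1 < \dots < i_s$, i.e. by a function \<open>i\<close> on \<open>{1..s}\<close>.
  The value \<open>T_elem i s q\<close> is $t_q$; it is meaningful only for \<open>q \<le> T_last i s\<close>,
  where \<open>T_last i s\<close> is $k$.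
\<close>

definition T_candidates :: "(nat \<Rightarrow> nat) \<Rightarrow> nat \<Rightarrow> nat set" where
  "T_candidates i u = {j. 1 \<le> j \<and> j < u \<and> i j < i (j + 1) - 1}"

primrec T_elem :: "(nat \<Rightarrow> nat) \<Rightarrow> nat \<Rightarrow> nat \<Rightarrow> nat" where
  "T_elem i s 0 = s"
| "T_elem i s (Suc q) = Max (T_candidates i (T_elem i s q))"

definition T_last :: "(nat \<Rightarrow> nat) \<Rightarrow> nat \<Rightarrow> nat" where
  "T_last i s = (LEAST q. T_candidates i (T_elem i s q) = {})"

definition T_set :: "(nat \<Rightarrow> nat) \<Rightarrow> nat \<Rightarrow> nat set" where
  "T_set i s = T_elem i s ` {0..T_last i s}"

text \<open>
  \<open>T'_elem i s j\<close> is $t'_{j+1}$ (the indices are shifted by one: $t'_1 = t_k$ is at \<open>j = 0\<close>);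
  it is meaningful only for \<open>j < T'_length i s\<close>, where \<open>T'_length i s\<close> is $r$.
  \<open>T'_desc i s j\<close> is $t_{k_j} = t'_{r-j+1}$, for \<open>1 \<le> j \<le> r\<close>.
\<close>

definition T'_candidates :: "(nat \<Rightarrow> nat) \<Rightarrow> nat \<Rightarrow> nat \<Rightarrow> nat set" where
  "T'_candidates i s u = {t \<in> T_set i s. i u < t \<and> i t \<le> s - 1}"

primrec T'_elem :: "(nat \<Rightarrow> nat) \<Rightarrow> nat \<Rightarrow> nat \<Rightarrow> nat" where
  "T'_elem i s 0 = T_elem i s (T_last i s)"
| "T'_elem i s (Suc j) = Min (T'_candidates i s (T'_elem i s j))"

definition T'_length :: "(nat \<Rightarrow> nat) \<Rightarrow> nat \<Rightarrow> nat" where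
  "T'_length i s = Suc (LEAST j. T'_candidates i s (T'_elem i s j) = {})"

definition T'_desc :: "(nat \<Rightarrow> nat) \<Rightarrow> nat \<Rightarrow> nat \<Rightarrow> nat" where
  "T'_desc i s j = T'_elem i s (T'_length i s - j)"

end

theory Submission
  imports Defs
begin

text \<open>
  The ideal \<open>sfBorel n m\<close> is the intersection of the prime ideals \<open>P\<^sub>F\<close> generated by the variables with
  index in \<open>F\<close>, where \<open>F\<close> runs over the subsets of \<open>{1..i p}\<close> with \<open>i p - p + 1\<close> elements, for
  \<open>p = 1, \<dots>, s\<close> (lemma \<open>sfBorel_eq_covers\<close>). The minimal ones among these sets give the prime
  components, and \<open>P\<^sub>F\<close> to the power \<open>q\<close> consists of the polynomials all of whose monomials have degree at
  least \<open>q\<close> in the variables of \<open>F\<close>. So the initial degree of the \<open>q\<close>-th symbolic power is the minimum of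
  the degree of \<open>u\<close> over all exponent vectors \<open>u\<close> whose sum over each \<open>F\<close> is at least \<open>q\<close>
  (lemma \<open>alpha_symbolic_power_covers\<close>). This minimum is subadditive in \<open>q\<close>; by Fekete's lemma the limit
  in the Waldschmidt constant exists, and a bound \<open>q * B\<close> on the minimum for every \<open>q\<close> gives the bound \<open>B\<close> on
  the constant (lemma \<open>waldschmidt_ge_if_covers_ge\<close>).

  It remains to bound the total of such a \<open>u\<close>. The constraints only get easier when the values
  are sorted decreasingly, since then large values move into the initial segments. For a decreasing sequence
  they imply that each window \<open>{p..i p}\<close> has sum at least \<open>q\<close>, hence average at least \<open>q / (i p - p + 1)\<close>,
  and a segment that starts before the window and ends inside it has at least that average
  (lemma \<open>segment_sum_ge_window_average\<close>). The tuple \<open>T'(m)\<close> is made for this: each element exceeds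
  the index at which the window of the preceding one ends. So the index range is cut into consecutive
  segments, one for each element of \<open>T'(m)\<close>, one up to \<open>s - 1\<close> that is compared with the
  window of \<open>t\<^sub>l\<close>, and finally the window \<open>{s..i s}\<close> itself; adding up their contributions is the
  stated bound (lemma \<open>covering_weight_ge\<close>).
\<close>

section \<open>Decreasing sequences and weighted covers\<close>

text \<open>
  If \<open>w b\<close> is nonnegative, so are all terms of the segment, as they come earlier. Otherwise everything
  after \<open>b\<close> is negative, so extending the segment to \<open>e\<close> only lowers its sum; the extended segment
  consists of the window \<open>{p..e}\<close> and of terms that are at least \<open>w p\<close>, which is nonnegative because
  it is the largest term of the window.
\<close>

lemma antimono_prefix_nonneg:
  fixes w :: "nat \<Rightarrow> real"
  assumes anti: "\<And>v v'. \<lbrakk>1 \<le> v; v \<le> v'; v' \<le> e\<rbrakk> \<Longrightarrow> w v' \<le> w v"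
    and "a < p" "p \<le> e" "a \<le> b" "b \<le> e" and nn: "(\<Sum>v=p..e. w v) \<ge> 0"
  shows "(\<Sum>v\<in>{a<..b}. w v) \<ge> 0"
proof (cases "b = a \<or> w b \<ge> 0")
  case True
  then show ?thesis
  proof
    assume "w b \<ge> 0"
    have "w b \<le> w v" if "v \<in> {a<..b}" for v
      using anti[of v b] that assms(5) by simp
    then show ?thesis using \<open>w b \<ge> 0\<close> by (intro sum_nonneg) (meson order_trans)
  qed simp
next
  case False
  have wp: "w p \<ge> 0"
  proof (rule ccontr)
    assume "\<not> w p \<ge> 0"
    moreover have "w v \<le> w p" if "v \<in> {p..e}" for v
      using anti[of p v] that assms(2) by simp
    ultimately have "(\<Sum>v=p..e. w v) < (\<Sum>v=p..e. 0)"
      using assms(3) by (intro sum_strict_mono) (auto simp: not_le intro: le_less_trans)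
    then show False using nn by simp
  qed
  have "w p \<le> w v" if "v \<in> {a<..<p}" for v
    using anti[of v p] that assms(3) by simp
  then have "0 \<le> (\<Sum>v\<in>{a<..<p}. w v)"
    using wp by (intro sum_nonneg) (meson order_trans)
  also have "\<dots> \<le> (\<Sum>v\<in>{a<..<p}. w v) + (\<Sum>v=p..e. w v)" using nn by simp
  also have "\<dots> = (\<Sum>v\<in>{a<..<p} \<union> {p..e}. w v)" by (rule sum.union_disjoint[symmetric]) auto
  also have "{a<..<p} \<union> {p..e} = {a<..b} \<union> {b<..e}" using assms by auto
  also have "(\<Sum>v\<in>{a<..b} \<union> {b<..e}. w v) = (\<Sum>v\<in>{a<..b}. w v) + (\<Sum>v\<in>{b<..e}. w v)"
    by (rule sum.union_disjoint) auto
  also have "(\<Sum>v\<in>{b<..e}. w v) \<le> 0"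
  proof (rule sum_nonpos)
    fix v assume "v \<in> {b<..e}"
    then have "w v \<le> w b" using anti[of b v] False assms(4) by simp
    then show "w v \<le> 0" using False by simp
  qed
  finally show ?thesis by simp
qed

text \<open>
  A segment of a decreasing sequence that starts before a window and stops within it has at least the
  average of the window. This is the source of every fraction in the bound; subtracting the average
  from the sequence reduces it to a statement about signs.
\<close>

lemma segment_sum_ge_window_average:
  fixes z :: "nat \<Rightarrow> real"
  assumes anti: "\<And>v v'. \<lbrakk>1 \<le> v; v \<le> v'; v' \<le> e\<rbrakk> \<Longrightarrow> z v' \<le> z v"
    and "a < p" "p \<le> e" "a \<le> b" "b \<le> e" and ge: "(\<Sum>v=p..e. z v) \<ge> q"
  shows "(\<Sum>v\<in>{a<..b}. z v) \<ge> q * ((real b - real a) / (real e - real p + 1))"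
proof -
  define A where "A = q / (real e - real p + 1)"
  have c: "real e - real p + 1 > 0" using assms(3) by simp
  have "(\<Sum>v\<in>{a<..b}. z v - A) \<ge> 0"
  proof (rule antimono_prefix_nonneg[where e = e and p = p])
    show "(\<Sum>v=p..e. z v - A) \<ge> 0"
    proof -
      have "(\<Sum>v=p..e. z v - A) = (\<Sum>v=p..e. z v) - (real e - real p + 1) * A"
        using assms(3) by (simp add: sum_subtractf of_nat_diff algebra_simps)
      also have "(real e - real p + 1) * A = q" using c by (simp add: A_def)
      finally show ?thesis using ge by simp
    qed
  qed (use assms in auto)
  then show ?thesis
    using assms(4) by (simp add: sum_subtractf A_def field_simps of_nat_diff)
qed

text \<open>
  Exchange argument: the indices of \<open>H\<close> outside the window are as many as those of the window outside
  \<open>H\<close>, and all of them lie beyond \<open>e\<close>, so \<open>z e\<close> separates the two groups of values.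
\<close>

lemma sum_le_leading_window:
  fixes z :: "nat \<Rightarrow> real"
  assumes anti: "\<And>v v'. \<lbrakk>1 \<le> v; v \<le> v'; v' \<le> n\<rbrakk> \<Longrightarrow> z v' \<le> z v"
    and "1 \<le> p" "p \<le> e" "e \<le> n" and H: "H \<subseteq> {p..n}" "card H = e - p + 1"
  shows "(\<Sum>v\<in>H. z v) \<le> (\<Sum>v=p..e. z v)"
proof -
  let ?W = "{p..e}"
  have fin: "finite H" using H(1) finite_subset by blast
  have cW: "card ?W = card H" using assms by simp
  have "card (H - ?W) = card (?W - H)"
    using fin cW by (simp add: card_Diff_subset_Int Int_commute)
  have "(\<Sum>v\<in>H - ?W. z v) \<le> of_nat (card (H - ?W)) * z e"
    using H(1) assms(2,3) by (intro sum_bounded_above anti) auto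
  also have "\<dots> = of_nat (card (?W - H)) * z e" by (simp add: \<open>card (H - ?W) = _\<close>)
  also have "\<dots> \<le> (\<Sum>v\<in>?W - H. z v)"
    using assms(2-4) by (intro sum_bounded_below anti) auto
  finally have "(\<Sum>v\<in>H - ?W. z v) \<le> (\<Sum>v\<in>?W - H. z v)" .
  then show ?thesis
    using sum.Int_Diff[OF fin, of z ?W] sum.Int_Diff[of ?W z H] by (simp add: Int_commute)
qed

lemma decreasing_rearrangement:
  fixes y :: "nat \<Rightarrow> real"
  obtains \<pi> where "bij_betw \<pi> {1..n} {1..n}"
    "\<And>v v'. \<lbrakk>1 \<le> v; v \<le> v'; v' \<le> n\<rbrakk> \<Longrightarrow> y (\<pi> v') \<le> y (\<pi> v)"
proof
  define xs where "xs = sort_key (\<lambda>v. - y v) [1..<n+1]"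
  have len: "length xs = n" by (simp add: xs_def)
  have "bij_betw ((!) xs) {..<n} {1..n}"
    by (intro bij_betw_nth) (auto simp: xs_def len)
  moreover have "bij_betw (\<lambda>v. v - 1) {1..n} {..<n}"
    by (rule bij_betw_byWitness[where f' = Suc]) auto
  ultimately show "bij_betw ((!) xs \<circ> (\<lambda>v. v - 1)) {1..n} {1..n}"
    by (rule bij_betw_trans[rotated])
  have "sorted (map (\<lambda>v. - y v) xs)" by (simp add: xs_def)
  then show "y (((!) xs \<circ> (\<lambda>v. v - 1)) v') \<le> y (((!) xs \<circ> (\<lambda>v. v - 1)) v)"
    if "1 \<le> v" "v \<le> v'" "v' \<le> n" for v v'
    using sorted_nth_mono[of "map (\<lambda>v. - y v) xs" "v - 1" "v' - 1"] that len by simp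
qed

text \<open>
  The constraint on the initial segment \<open>{1..e}\<close> says that even its \<open>e - p + 1\<close> smallest values sum up
  to \<open>q\<close>. Sorting moves the largest values to the front. Only \<open>p - 1\<close> values are placed in front of
  the window, so they leave at least \<open>e - p + 1\<close> indices of \<open>{1..e}\<close>. The values of that many of them sum up
  to at least \<open>q\<close>, and the window holds the largest values among all that remain.
\<close>

lemma rearranged_window_ge:
  fixes y :: "nat \<Rightarrow> real"
  assumes bij: "bij_betw \<pi> {1..n} {1..n}"
    and anti: "\<And>v v'. \<lbrakk>1 \<le> v; v \<le> v'; v' \<le> n\<rbrakk> \<Longrightarrow> y (\<pi> v') \<le> y (\<pi> v)"
    and "1 \<le> p" "p \<le> e" "e \<le> n"
    and ge: "\<And>F. \<lbrakk>F \<subseteq> {1..e}; card F = e - p + 1\<rbrakk> \<Longrightarrow> q \<le> (\<Sum>v\<in>F. y v)"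
  shows "q \<le> (\<Sum>v=p..e. y (\<pi> v))"
proof -
  have inj: "inj_on \<pi> {1..n}" and im: "\<pi> ` {1..n} = {1..n}"
    using bij by (auto simp: bij_betw_def)
  let ?A = "\<pi> ` {1..<p}"
  have "card ?A = p - 1"
    using card_image[OF inj_on_subset[OF inj, of "{1..<p}"]] assms(4,5) by fastforce
  then have "e - p + 1 \<le> card ({1..e} - ?A)"
    using diff_card_le_card_Diff[of ?A "{1..e}"] assms(3,4) by simp
  then obtain F where F: "F \<subseteq> {1..e} - ?A" "card F = e - p + 1"
    by (meson obtain_subset_with_card_n)
  define H where "H = {v \<in> {1..n}. \<pi> v \<in> F}"
  have "F \<subseteq> \<pi> ` {1..n}" using F(1) assms(5) unfolding im by auto
  then have FH: "F = \<pi> ` H" unfolding H_def by blast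
  have injH: "inj_on \<pi> H" by (rule inj_on_subset[OF inj]) (auto simp: H_def)
  have "H \<subseteq> {p..n}"
  proof
    fix v assume "v \<in> H"
    then have "v \<in> {1..n}" "\<pi> v \<notin> ?A" using F(1) by (auto simp: H_def)
    then show "v \<in> {p..n}" by (cases "v < p") auto
  qed
  moreover have "card H = e - p + 1" using F(2) FH card_image[OF injH] by simp
  ultimately have "(\<Sum>v\<in>H. y (\<pi> v)) \<le> (\<Sum>v=p..e. y (\<pi> v))"
    using anti assms(3-5) by (intro sum_le_leading_window[where n = n]) auto
  moreover have "q \<le> (\<Sum>v\<in>H. y (\<pi> v))"
    using ge[of F] F FH sum.reindex[OF injH, of y] by auto
  ultimately show ?thesis by simp
qed

text \<open>
  After sorting, \<open>{0<..i s}\<close> is cut at the places \<open>i (\<tau> 0)\<close>, \<dots>, \<open>i (\<tau> r)\<close> and \<open>s - 1\<close>. The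
  condition \<open>i (\<tau> j) < \<tau> (Suc j)\<close> says that the piece ending at \<open>i (\<tau> (Suc j))\<close> starts before the window
  of \<open>\<tau> (Suc j)\<close>, so it has at least the average of that window; the same holds for the piece ending at
  \<open>s - 1\<close> and the window of \<open>p\<close>. The last piece is the window of \<open>s\<close> and contributes the summand 1.
\<close>

lemma covering_weight_ge:
  fixes y :: "nat \<Rightarrow> real" and i \<tau> :: "nat \<Rightarrow> nat"
  assumes nonneg: "\<And>v. y v \<ge> 0"
    and i_le: "\<And>p. p \<in> {1..s} \<Longrightarrow> p \<le> i p \<and> i p \<le> n"
    and cover: "\<And>p F. \<lbrakk>p \<in> {1..s}; F \<subseteq> {1..i p}; card F = i p - p + 1\<rbrakk> \<Longrightarrow> q \<le> (\<Sum>v\<in>F. y v)"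
    and \<tau>: "\<And>j. j \<le> r \<Longrightarrow> \<tau> j \<in> {1..s}"
    and chain: "\<And>j. j < r \<Longrightarrow> i (\<tau> j) < \<tau> (Suc j)"
    and last: "i (\<tau> r) < s"
    and p: "p \<in> {1..s}" "i (\<tau> r) < p" "s \<le> i p"
  shows "(\<Sum>v=1..n. y v) \<ge> q * (1 + (real s - real (i (\<tau> r)) - 1) / (real (i p) - real p + 1)
           + real (i (\<tau> 0)) / (real (i (\<tau> 0)) - real (\<tau> 0) + 1)
           + (\<Sum>j<r. (real (i (\<tau> (Suc j))) - real (i (\<tau> j))) /
                      (real (i (\<tau> (Suc j))) - real (\<tau> (Suc j)) + 1)))"
proof -
  obtain \<pi> where bij: "bij_betw \<pi> {1..n} {1..n}"
    and anti: "\<And>v v'. \<lbrakk>1 \<le> v; v \<le> v'; v' \<le> n\<rbrakk> \<Longrightarrow> y (\<pi> v') \<le> y (\<pi> v)"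
    using decreasing_rearrangement by blast
  define z where "z v = y (\<pi> v)" for v
  have window: "q \<le> (\<Sum>v=p..i p. z v)" if "p \<in> {1..s}" for p
    unfolding z_def
    by (rule rearranged_window_ge[of \<pi> n y p "i p" q])
      (use that i_le[OF that] cover bij anti in auto)
  have step: "(\<Sum>v\<in>{a<..b}. z v) \<ge> q * ((real b - real a) / (real (i p) - real p + 1))"
    if "p \<in> {1..s}" "a < p" "a \<le> b" "b \<le> i p" for a b p
    by (rule segment_sum_ge_window_average[OF _ _ _ _ _ window])
      (use that i_le[OF that(1)] anti in \<open>auto simp: z_def\<close>)
  have glue: "(\<Sum>v\<in>{a<..b}. z v) + (\<Sum>v\<in>{b<..c}. z v) = (\<Sum>v\<in>{a<..c}. z v)"
    if "a \<le> b" "b \<le> c" for a b c :: nat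
    using that by (subst sum.union_disjoint[symmetric]) (auto intro!: sum.cong)
  have prefix: "(\<Sum>v\<in>{0<..i (\<tau> k)}. z v) \<ge>
      q * (real (i (\<tau> 0)) / (real (i (\<tau> 0)) - real (\<tau> 0) + 1)
           + (\<Sum>j<k. (real (i (\<tau> (Suc j))) - real (i (\<tau> j))) /
                      (real (i (\<tau> (Suc j))) - real (\<tau> (Suc j)) + 1)))" if "k \<le> r" for k
    using that
  proof (induction k)
    case 0
    then show ?case using step[of "\<tau> 0" 0 "i (\<tau> 0)"] \<tau>[of 0] by simp
  next
    case (Suc k)
    have lt: "i (\<tau> k) < \<tau> (Suc k)" and mem: "\<tau> (Suc k) \<in> {1..s}"
      using chain \<tau> Suc.prems by auto
    then have le: "i (\<tau> k) \<le> i (\<tau> (Suc k))" using i_le[OF mem] by simp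
    then show ?case
      using Suc.IH Suc.prems step[OF mem lt le] glue[of 0 "i (\<tau> k)" "i (\<tau> (Suc k))"]
      by (simp add: algebra_simps)
  qed
  have le: "i (\<tau> r) \<le> s - 1" "s - 1 \<le> i s" "s \<in> {1..s}" "i s \<le> n"
    using last p i_le[of s] by auto
  have window_s: "q \<le> (\<Sum>v\<in>{s-1<..i s}. z v)"
  proof -
    have "{s-1<..i s} = {s..i s}" using le by auto
    then show ?thesis using window[of s] le by simp
  qed
  have "q * ((real (s - 1) - real (i (\<tau> r))) / (real (i p) - real p + 1))
       \<le> (\<Sum>v\<in>{i (\<tau> r)<..s-1}. z v)"
    using p le by (intro step) auto
  with prefix[of r] window_s
  have "q * (1 + (real s - real (i (\<tau> r)) - 1) / (real (i p) - real p + 1)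
           + real (i (\<tau> 0)) / (real (i (\<tau> 0)) - real (\<tau> 0) + 1)
           + (\<Sum>j<r. (real (i (\<tau> (Suc j))) - real (i (\<tau> j))) /
                      (real (i (\<tau> (Suc j))) - real (\<tau> (Suc j)) + 1)))
     \<le> (\<Sum>v\<in>{0<..i s}. z v)"
    using glue[of 0 "i (\<tau> r)" "s - 1"] glue[of 0 "s - 1" "i s"] le
    by (simp add: algebra_simps of_nat_diff)
  also have "\<dots> \<le> (\<Sum>v=1..n. z v)"
    using le nonneg by (intro sum_mono2) (auto simp: z_def)
  also have "\<dots> = (\<Sum>v=1..n. y v)" unfolding z_def by (rule sum.reindex_bij_betw[OF bij])
  finally show ?thesis .
qed

section \<open>Subadditive sequences\<close>

text \<open>
  Fekete's lemma: the quotients converge to their infimum, since dividing \<open>q\<close> by a fixed \<open>p\<close> with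
  remainder gives \<open>a q / q \<le> a p / p + C / q\<close> with \<open>C\<close> depending only on \<open>p\<close>.
\<close>

lemma subadditive_nat_convergent:
  fixes a :: "nat \<Rightarrow> nat"
  assumes sub: "\<And>p q. a (p + q) \<le> a p + a q"
  shows "convergent (\<lambda>q. real (a q) / real q)"
proof -
  define L where "L = (INF q\<in>{1..}. real (a q) / real q)"
  have bdd: "bdd_below ((\<lambda>q. real (a q) / real q) ` {1..})" by (rule bdd_belowI[of _ 0]) auto
  have mult: "a (k * p + t) \<le> k * a p + t * a 1 + a 0" for k p t
  proof -
    have "a (k * p + x) \<le> k * a p + a x" for x
    proof (induction k)
      case (Suc k)
      then show ?case using sub[of p "k * p + x"] by (simp add: algebra_simps)
    qed simp
    moreover have "a t \<le> t * a 1 + a 0"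
    proof (induction t)
      case (Suc t)
      then show ?case using sub[of 1 t] by simp
    qed simp
    ultimately show ?thesis by (metis add.assoc add_le_cancel_left order_trans)
  qed
  have "(\<lambda>q. real (a q) / real q) \<longlonglongrightarrow> L"
  proof (rule LIMSEQ_I)
    fix e :: real assume e: "e > 0"
    obtain p where p: "p \<ge> 1" "real (a p) / real p < L + e / 2"
      using cINF_less_iff[OF _ bdd, of "L + e/2"] e unfolding L_def by auto
    define C where "C = real p * real (a 1) + real (a 0)"
    obtain N where N: "real N > 2 * C / e" using reals_Archimedean2 by blast
    have "\<bar>real (a q) / real q - L\<bar> < e" if q: "q \<ge> Suc N" for q
    proof -
      have q0: "real q > 0" using q by simp
      have "L \<le> real (a q) / real q" unfolding L_def using q by (intro cINF_lower[OF bdd]) auto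
      have "real (a q) \<le> real ((q div p) * a p + (q mod p) * a 1 + a 0)"
        using mult[of "q div p" p "q mod p"] by (simp only: div_mult_mod_eq of_nat_le_iff)
      also have "\<dots> = real (q div p) * real (a p) + real (q mod p) * real (a 1) + real (a 0)" by simp
      also have "\<dots> \<le> (real q / real p) * real (a p) + real p * real (a 1) + real (a 0)"
        using p(1) by (intro add_mono mult_right_mono order_refl of_nat_div_le_of_nat) auto
      also have "\<dots> = real q * (real (a p) / real p) + C" by (simp add: C_def)
      finally have "real (a q) / real q \<le> real (a p) / real p + C / real q"
        using q0 by (simp add: field_simps)
      moreover have "C / real q < e / 2"
      proof -
        have "real q > 2 * C / e" using N q by linarith
        then show ?thesis using e q0 by (simp add: field_simps)
      qed
      ultimately show ?thesis using p(2) \<open>L \<le> _\<close> by linarith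
    qed
    then show "\<exists>no. \<forall>q\<ge>no. norm (real (a q) / real q - L) < e"
      unfolding real_norm_def by blast
  qed
  then show ?thesis by (rule convergentI)
qed

section \<open>The tuples T(m) and T'(m)\<close>

lemma T_elem_mem:
  assumes "1 \<le> s" "q \<le> T_last i s"
  shows "T_elem i s q \<in> {1..s}"
  using assms(2)
proof (induction q)
  case 0
  then show ?case using assms(1) by simp
next
  case (Suc q)
  let ?C = "T_candidates i (T_elem i s q)"
  have "?C \<noteq> {}"
    using Suc.prems not_less_Least[of q "\<lambda>q. T_candidates i (T_elem i s q) = {}"]
    unfolding T_last_def by simp
  moreover have "finite ?C" by (rule finite_subset[of _ "{..T_elem i s q}"]) (auto simp: T_candidates_def)
  ultimately have "Max ?C \<in> ?C" by simp
  then show ?case using Suc by (auto simp: T_candidates_def)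
qed

lemma T_set_subset: "1 \<le> s \<Longrightarrow> T_set i s \<subseteq> {1..s}"
  using T_elem_mem unfolding T_set_def by fastforce

lemma T'_elem_mem_if_candidates:
  assumes "T'_candidates i s (T'_elem i s j) \<noteq> {}"
  shows "T'_elem i s (Suc j) \<in> T'_candidates i s (T'_elem i s j)"
proof -
  have "finite (T'_candidates i s (T'_elem i s j))"
    by (rule finite_subset[of _ "T_set i s"]) (auto simp: T'_candidates_def T_set_def)
  then show ?thesis using Min_in[OF _ assms] by simp
qed

text \<open>
  The recursion stops: as long as there is a candidate, \<open>i (T'_elem i s j)\<close> increases with \<open>j\<close>, because
  \<open>i t \<ge> t > i (T'_elem i s j)\<close> for a candidate \<open>t\<close>, yet it never exceeds \<open>s - 1\<close>.
\<close>

lemma T'_elem_exhausted: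
  assumes s: "1 \<le> s" and i_ge: "\<And>p. p \<in> {1..s} \<Longrightarrow> p \<le> i p"
  shows "T'_candidates i s (T'_elem i s (T'_length i s - 1)) = {}"
proof -
  have "\<exists>j. T'_candidates i s (T'_elem i s j) = {}"
  proof (rule ccontr)
    assume "\<nexists>j. T'_candidates i s (T'_elem i s j) = {}"
    then have cand: "T'_elem i s (Suc j) \<in> T'_candidates i s (T'_elem i s j)" for j
      using T'_elem_mem_if_candidates by blast
    have "j \<le> i (T'_elem i s j)" for j
    proof (induction j)
      case (Suc j)
      have "T'_elem i s (Suc j) \<in> {1..s}" "i (T'_elem i s j) < T'_elem i s (Suc j)"
        using cand[of j] T_set_subset[OF s, of i] unfolding T'_candidates_def by blast+
      then show ?case using Suc i_ge by fastforce
    qed simp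
    then have "s \<le> i (T'_elem i s (Suc s))" using Suc_leD by blast
    then show False using cand[of s] s by (auto simp: T'_candidates_def)
  qed
  then show ?thesis unfolding T'_length_def by (metis (mono_tags, lifting) LeastI_ex diff_Suc_1)
qed

lemma T'_elem_Suc_mem:
  assumes "Suc j < T'_length i s"
  shows "T'_elem i s (Suc j) \<in> T'_candidates i s (T'_elem i s j)"
  using assms not_less_Least[of j "\<lambda>j. T'_candidates i s (T'_elem i s j) = {}"]
  unfolding T'_length_def
  by (intro T'_elem_mem_if_candidates) auto

lemma T'_elem_in_T_set: "j < T'_length i s \<Longrightarrow> T'_elem i s j \<in> T_set i s"
  using T'_elem_Suc_mem by (cases j) (auto simp: T_set_def T'_candidates_def)

section \<open>Monomial ideals\<close>

text \<open>
  For \<open>U\<close> closed under multiplication by monomials this is the monomial ideal whose monomials are those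
  of \<open>U\<close>. The other sets that occur, the monomials without a variable from some \<open>F\<close>, give the subring of
  polynomials in the remaining variables.
\<close>

definition mon_ideal :: "nat \<Rightarrow> monom set \<Rightarrow> ('a::field) mpoly set" where
  "mon_ideal n U = {p. \<forall>u\<in>Poly_Mapping.keys p. Poly_Mapping.keys u \<subseteq> {1..n} \<and> u \<in> U}"

text \<open>
  The order of \<open>u\<close> along the prime ideal generated by the variables of \<open>F\<close>: the monomial \<open>u\<close> lies in the
  \<open>q\<close>-th power of that ideal iff this number is at least \<open>q\<close>.
\<close>

definition weight :: "nat set \<Rightarrow> monom \<Rightarrow> nat" where
  "weight F u = (\<Sum>v\<in>F. Poly_Mapping.lookup u v)"

lemma weight_zero [simp]: "weight F 0 = 0"
  by (simp add: weight_def)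

lemma weight_add: "weight F (u + w) = weight F u + weight F w"
  by (simp add: weight_def lookup_add sum.distrib)

lemma weight_single: "finite F \<Longrightarrow> weight F (Poly_Mapping.single v c) = (if v \<in> F then c else 0)"
  by (simp add: weight_def lookup_single when_def)

lemma weight_sum: "weight F (sum f A) = (\<Sum>a\<in>A. weight F (f a))"
  by (induction A rule: infinite_finite_induct) (auto simp: weight_add)

lemma keys_add_monom: "Poly_Mapping.keys (u + w :: monom) = Poly_Mapping.keys u \<union> Poly_Mapping.keys w"
  by (auto simp: in_keys_iff lookup_add)

lemma carrier_poly_ring: "carrier (poly_ring n) = mon_ideal n UNIV"
  by (simp add: poly_ring_def mon_ideal_def)

lemma poly_ring_simps [simp]:
  "mult (poly_ring n) = (*)" "one (poly_ring n) = 1"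
  "zero (poly_ring n) = 0" "add (poly_ring n) = (+)"
  by (simp_all add: poly_ring_def)

lemma mon_ideal_zero: "0 \<in> mon_ideal n U"
  by (simp add: mon_ideal_def)

lemma mon_ideal_add: "\<lbrakk>p \<in> mon_ideal n U; q \<in> mon_ideal n U\<rbrakk> \<Longrightarrow> p + q \<in> mon_ideal n U"
  using Poly_Mapping.keys_add[of p q] unfolding mon_ideal_def by blast

lemma mon_ideal_uminus: "p \<in> mon_ideal n U \<Longrightarrow> - p \<in> mon_ideal n U"
  by (simp add: mon_ideal_def in_keys_iff)

lemma mon_ideal_mult:
  assumes "p \<in> mon_ideal n U" "q \<in> mon_ideal n V" "\<And>u w. \<lbrakk>u \<in> U; w \<in> V\<rbrakk> \<Longrightarrow> u + w \<in> W"
  shows "p * q \<in> mon_ideal n W"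
  unfolding mon_ideal_def
proof (intro CollectI ballI)
  fix x assume "x \<in> Poly_Mapping.keys (p * q)"
  then obtain u w where "x = u + w" "u \<in> Poly_Mapping.keys p" "w \<in> Poly_Mapping.keys q"
    using keys_mult[of p q] by auto
  then show "Poly_Mapping.keys x \<subseteq> {1..n} \<and> x \<in> W"
    using assms by (auto simp: mon_ideal_def keys_add_monom)
qed

lemma monom_poly_in_mon_ideal_iff:
  "(monom_poly u :: ('a::field) mpoly) \<in> mon_ideal n U \<longleftrightarrow> Poly_Mapping.keys u \<subseteq> {1..n} \<and> u \<in> U"
  by (simp add: monom_poly_def mon_ideal_def)

lemma monom_poly_add: "(monom_poly (u + w) :: ('a::field) mpoly) = monom_poly u * monom_poly w"
  by (simp add: monom_poly_def mult_single)

lemma mon_ideal_cong: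
  "(\<And>u. Poly_Mapping.keys u \<subseteq> {1..n} \<Longrightarrow> u \<in> U \<longleftrightarrow> u \<in> V) \<Longrightarrow> mon_ideal n U = mon_ideal n V"
  by (auto simp: mon_ideal_def)

lemma poly_ring_cring: "cring (poly_ring n :: ('a::field) mpoly ring)"
proof (rule cringI)
  show "abelian_group (poly_ring n :: 'a mpoly ring)"
  proof (rule abelian_groupI)
    show "\<exists>y\<in>carrier (poly_ring n). y \<oplus>\<^bsub>poly_ring n\<^esub> x = \<zero>\<^bsub>poly_ring n\<^esub>"
      if "x \<in> carrier (poly_ring n)" for x :: "'a mpoly"
      by (rule bexI[of _ "- x"]) (use that mon_ideal_uminus in \<open>auto simp: carrier_poly_ring\<close>)
  qed (auto simp: carrier_poly_ring mon_ideal_zero intro: mon_ideal_add)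
  show "Group.comm_monoid (poly_ring n :: 'a mpoly ring)"
  proof (rule comm_monoidI)
    show "\<one>\<^bsub>poly_ring n\<^esub> \<in> carrier (poly_ring n :: 'a mpoly ring)"
      by (simp add: poly_ring_def)
  qed (auto simp: carrier_poly_ring mult.assoc mult.commute intro: mon_ideal_mult)
qed (simp add: distrib_right)

lemma poly_ring_ring: "ring (poly_ring n :: ('a::field) mpoly ring)"
  using poly_ring_cring by (rule cring.axioms)

lemma poly_ring_a_inv:
  assumes "p \<in> carrier (poly_ring n :: ('a::field) mpoly ring)"
  shows "\<ominus>\<^bsub>poly_ring n\<^esub> p = - p"
proof -
  interpret ring "poly_ring n :: 'a mpoly ring" by (rule poly_ring_ring)
  show ?thesis
    by (rule minus_equality) (use assms mon_ideal_uminus in \<open>auto simp: carrier_poly_ring\<close>)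
qed

lemma mon_ideal_ideal:
  assumes "\<And>u w. u \<in> U \<Longrightarrow> u + w \<in> U"
  shows "ideal (mon_ideal n U) (poly_ring n :: ('a::field) mpoly ring)"
proof (rule idealI[OF poly_ring_ring])
  interpret ring "poly_ring n :: 'a mpoly ring" by (rule poly_ring_ring)
  have sub: "mon_ideal n U \<subseteq> carrier (poly_ring n :: 'a mpoly ring)"
    by (auto simp: carrier_poly_ring mon_ideal_def)
  show "subgroup (mon_ideal n U) (add_monoid (poly_ring n :: 'a mpoly ring))"
  proof (rule add.subgroupI)
    show "\<ominus>\<^bsub>poly_ring n\<^esub> p \<in> mon_ideal n U" if "p \<in> mon_ideal n U" for p :: "'a mpoly"
      using that sub poly_ring_a_inv mon_ideal_uminus by (metis subsetD)
  qed (use sub in \<open>auto intro: mon_ideal_add mon_ideal_zero\<close>)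
  fix a x :: "'a mpoly" assume a: "a \<in> mon_ideal n U" and x: "x \<in> carrier (poly_ring n)"
  have "a * x \<in> mon_ideal n U"
    using a x assms unfolding carrier_poly_ring by (rule mon_ideal_mult)
  then show "a \<otimes>\<^bsub>poly_ring n\<^esub> x \<in> mon_ideal n U" "x \<otimes>\<^bsub>poly_ring n\<^esub> a \<in> mon_ideal n U"
    by (simp_all add: mult.commute)
qed

lemma sum_terms:
  "(p :: ('a::field) mpoly) = (\<Sum>u\<in>Poly_Mapping.keys p. Poly_Mapping.single u (Poly_Mapping.lookup p u))"
  by (rule poly_mapping_eqI) (simp add: lookup_sum lookup_single when_def in_keys_iff)

lemma mem_ideal_if_monomials_mem:
  fixes p :: "('a::field) mpoly"
  assumes J: "ideal J (poly_ring n)"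
    and mem: "\<And>u. u \<in> Poly_Mapping.keys p \<Longrightarrow> monom_poly u \<in> J"
  shows "p \<in> J"
proof -
  interpret ideal J "poly_ring n :: 'a mpoly ring" by (rule J)
  have "(\<Sum>u\<in>A. Poly_Mapping.single u (Poly_Mapping.lookup p u)) \<in> J"
    if "finite A" "A \<subseteq> Poly_Mapping.keys p" for A
    using that
  proof (induction A rule: finite_induct)
    case empty
    have "\<zero>\<^bsub>poly_ring n\<^esub> \<in> J" by (rule additive_subgroup.zero_closed) (rule is_additive_subgroup)
    then show ?case by simp
  next
    case (insert u A)
    have "Poly_Mapping.single 0 (Poly_Mapping.lookup p u) * monom_poly u \<in> J"
      using I_l_closed[of "monom_poly u" "Poly_Mapping.single 0 (Poly_Mapping.lookup p u)"] mem insert.prems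
      by (simp add: carrier_poly_ring mon_ideal_def)
    then have "Poly_Mapping.single u (Poly_Mapping.lookup p u) \<in> J"
      by (simp add: monom_poly_def mult_single)
    then show ?case
      using insert additive_subgroup.a_closed[OF is_additive_subgroup] by fastforce
  qed
  from this[of "Poly_Mapping.keys p"] show ?thesis using sum_terms[of p] by fastforce
qed

lemma genideal_monomials:
  assumes G: "\<And>g. g \<in> G \<Longrightarrow> Poly_Mapping.keys g \<subseteq> {1..n}"
  shows "Idl\<^bsub>poly_ring n\<^esub> (monom_poly ` G) =
         (mon_ideal n {g + w | g w. g \<in> G} :: ('a::field) mpoly set)"
    (is "Idl\<^bsub>?R\<^esub> ?M = mon_ideal n ?U")
proof
  interpret ring "poly_ring n :: 'a mpoly ring" by (rule poly_ring_ring)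
  have sub: "?M \<subseteq> carrier ?R"
    using G by (auto simp: carrier_poly_ring monom_poly_in_mon_ideal_iff)
  have "ideal (mon_ideal n ?U) ?R" by (rule mon_ideal_ideal) (auto, metis add.assoc)
  moreover have "?M \<subseteq> mon_ideal n ?U"
    using G by (force simp: monom_poly_in_mon_ideal_iff intro: exI[of _ 0])
  ultimately show "Idl\<^bsub>?R\<^esub> ?M \<subseteq> mon_ideal n ?U" by (rule genideal_minimal)
  show "mon_ideal n ?U \<subseteq> Idl\<^bsub>?R\<^esub> ?M"
  proof
    interpret J: ideal "Idl\<^bsub>?R\<^esub> ?M" ?R by (rule genideal_ideal[OF sub])
    fix p :: "'a mpoly" assume p: "p \<in> mon_ideal n ?U"
    show "p \<in> Idl\<^bsub>?R\<^esub> ?M"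
    proof (rule mem_ideal_if_monomials_mem[OF J.is_ideal])
      fix u assume "u \<in> Poly_Mapping.keys p"
      then obtain g w where u: "u = g + w" "g \<in> G" "Poly_Mapping.keys u \<subseteq> {1..n}"
        using p by (auto simp: mon_ideal_def)
      then have "monom_poly w \<in> carrier ?R"
        by (auto simp: carrier_poly_ring monom_poly_in_mon_ideal_iff keys_add_monom)
      moreover have "monom_poly g \<in> Idl\<^bsub>?R\<^esub> ?M" using genideal_self[OF sub] u(2) by blast
      ultimately show "monom_poly u \<in> Idl\<^bsub>?R\<^esub> ?M"
        using J.I_r_closed u(1) by (simp add: monom_poly_add)
    qed
  qed
qed

lemma split_terms:
  fixes p :: "('a::field) mpoly"
  obtains p0 p1 where "p = p0 + p1"
    "Poly_Mapping.keys p0 = {u \<in> Poly_Mapping.keys p. Q u}"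
    "Poly_Mapping.keys p1 = {u \<in> Poly_Mapping.keys p. \<not> Q u}"
proof -
  define part where "part A = (\<Sum>u\<in>A. Poly_Mapping.single u (Poly_Mapping.lookup p u))" for A
  have look: "Poly_Mapping.lookup (part A) v = (if v \<in> A then Poly_Mapping.lookup p v else 0)"
    if "finite A" for A v
    using that by (simp add: part_def lookup_sum lookup_single when_def)
  let ?A = "{u \<in> Poly_Mapping.keys p. Q u}" and ?B = "{u \<in> Poly_Mapping.keys p. \<not> Q u}"
  show thesis
  proof
    show "p = part ?A + part ?B"
      by (rule poly_mapping_eqI) (auto simp: lookup_add look in_keys_iff)
    show "Poly_Mapping.keys (part ?A) = ?A" by (auto simp: look in_keys_iff split: if_splits)
    show "Poly_Mapping.keys (part ?B) = ?B" by (auto simp: look in_keys_iff split: if_splits)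
  qed
qed

text \<open>
  Modulo the ideal, a polynomial equals its part of weight zero. The product of two nonzero parts of
  weight zero is nonzero, as polynomials form an integral domain, and again has weight zero; hence it
  is not in the ideal.
\<close>

lemma variables_ideal_prime:
  "primeideal (mon_ideal n {u. 1 \<le> weight F u}) (poly_ring n :: ('a::field) mpoly ring)"
    (is "primeideal ?P ?R")
proof (rule primeidealI)
  show ideal: "ideal ?P ?R" by (rule mon_ideal_ideal) (simp add: weight_add)
  show "cring ?R" by (rule poly_ring_cring)
  have "(1 :: 'a mpoly) \<notin> ?P" by (simp add: mon_ideal_def)
  moreover have "(1 :: 'a mpoly) \<in> carrier ?R" by (simp add: poly_ring_def)
  ultimately show "carrier ?R \<noteq> ?P" by blast
next
  fix a b :: "'a mpoly"
  assume a: "a \<in> carrier ?R" and b: "b \<in> carrier ?R" and ab: "a \<otimes>\<^bsub>?R\<^esub> b \<in> ?P"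
  obtain a0 a1 where a01: "a = a0 + a1"
    "Poly_Mapping.keys a0 = {u \<in> Poly_Mapping.keys a. weight F u = 0}"
    "Poly_Mapping.keys a1 = {u \<in> Poly_Mapping.keys a. weight F u \<noteq> 0}"
    by (rule split_terms)
  obtain b0 b1 where b01: "b = b0 + b1"
    "Poly_Mapping.keys b0 = {u \<in> Poly_Mapping.keys b. weight F u = 0}"
    "Poly_Mapping.keys b1 = {u \<in> Poly_Mapping.keys b. weight F u \<noteq> 0}"
    by (rule split_terms)
  have mem: "a1 \<in> ?P" "b1 \<in> ?P" "a0 \<in> mon_ideal n {u. weight F u = 0}"
    "b0 \<in> mon_ideal n {u. weight F u = 0}"
    using a b a01 b01 by (auto simp: carrier_poly_ring mon_ideal_def)
  have "a0 * b1 \<in> ?P" "a1 * b \<in> ?P"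
    using mem(2,3) mem(1) b unfolding carrier_poly_ring
    by (auto elim!: mon_ideal_mult simp: weight_add)
  then have "- (a0 * b1 + a1 * b) \<in> ?P" by (intro mon_ideal_uminus mon_ideal_add)
  then have "a * b + - (a0 * b1 + a1 * b) \<in> ?P" using ab by (intro mon_ideal_add) auto
  also have "a * b + - (a0 * b1 + a1 * b) = a0 * b0" by (simp add: a01(1) b01(1) algebra_simps)
  finally have "a0 * b0 \<in> ?P" .
  moreover have "a0 * b0 \<in> mon_ideal n {u. weight F u = 0}"
    using mem(3,4) by (rule mon_ideal_mult) (simp add: weight_add)
  ultimately have "Poly_Mapping.keys (a0 * b0) = {}" by (force simp: mon_ideal_def)
  then have "a0 = 0 \<or> b0 = 0" by simp
  then show "a \<in> ?P \<or> b \<in> ?P" using a01(1) b01(1) mem(1,2) by auto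
qed

text \<open>
  A monomial of weight at least \<open>Suc q\<close> is divisible by a variable from \<open>F\<close>, and the quotient has weight at
  least \<open>q\<close>; this is the inclusion that needs an argument.
\<close>

lemma variables_ideal_power:
  assumes F: "F \<subseteq> {1..n}"
  shows "mon_ideal n {u. 1 \<le> weight F u} [^]\<^bsub>ideals_set (poly_ring n)\<^esub> q =
         (mon_ideal n {u. q \<le> weight F u} :: ('a::field) mpoly set)"
proof (induction q)
  case 0
  then show ?case by (simp add: ideals_set_def carrier_poly_ring nat_pow_def)
next
  case (Suc q)
  let ?R = "poly_ring n :: 'a mpoly ring"
  let ?M = "\<lambda>q. mon_ideal n {u. q \<le> weight F u} :: 'a mpoly set"
  interpret ring ?R by (rule poly_ring_ring)
  have ideal: "ideal (?M q) ?R" for q by (rule mon_ideal_ideal) (simp add: weight_add)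
  have "?M q \<cdot>\<^bsub>?R\<^esub> ?M 1 = ?M (Suc q)"
  proof
    show "?M q \<cdot>\<^bsub>?R\<^esub> ?M 1 \<subseteq> ?M (Suc q)"
    proof
      fix p assume "p \<in> ?M q \<cdot>\<^bsub>?R\<^esub> ?M 1"
      then show "p \<in> ?M (Suc q)"
      proof (induction p rule: ideal_prod.induct)
        case (prod a b)
        then have "a * b \<in> ?M (Suc q)" by (rule mon_ideal_mult) (simp add: weight_add)
        then show ?case by simp
      next
        case (sum p p')
        then show ?case by (simp add: mon_ideal_add)
      qed
    qed
    show "?M (Suc q) \<subseteq> ?M q \<cdot>\<^bsub>?R\<^esub> ?M 1"
    proof
      fix p assume p: "p \<in> ?M (Suc q)"
      show "p \<in> ?M q \<cdot>\<^bsub>?R\<^esub> ?M 1"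
      proof (rule mem_ideal_if_monomials_mem[OF ideal_prod_is_ideal[OF ideal ideal]])
        fix u assume "u \<in> Poly_Mapping.keys p"
        then have u: "Poly_Mapping.keys u \<subseteq> {1..n}" "Suc q \<le> weight F u"
          using p by (auto simp: mon_ideal_def)
        then have "weight F u \<noteq> 0" by simp
        then obtain v where v: "v \<in> F" "Poly_Mapping.lookup u v \<noteq> 0"
          unfolding weight_def by (meson sum.neutral)
        define e where "e = Poly_Mapping.single v (1::nat)"
        have ue: "u = (u - e) + e"
          using v(2) by (intro poly_mapping_eqI) (auto simp: e_def lookup_add lookup_minus lookup_single when_def)
        have "weight F e = 1"
          using v(1) F finite_subset[OF F] by (simp add: e_def weight_single)
        moreover from this have "q \<le> weight F (u - e)"
          using u(2) weight_add[of F "u - e" e] ue by simp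
        moreover have "Poly_Mapping.keys (u - e) \<subseteq> {1..n}" "Poly_Mapping.keys e \<subseteq> {1..n}"
          using u(1) ue keys_add_monom[of "u - e" e] by auto
        ultimately have "monom_poly (u - e) \<in> ?M q" "monom_poly e \<in> ?M 1"
          by (auto simp: monom_poly_in_mon_ideal_iff)
        from ideal_prod.prod[OF this, of ?R] show "monom_poly u \<in> ?M q \<cdot>\<^bsub>?R\<^esub> ?M 1"
          using ue by (simp flip: monom_poly_add)
      qed
    qed
  qed
  then show ?case using Suc by (simp add: ideals_set_def nat_pow_def)
qed

section \<open>Uniqueness of prime decompositions\<close>

text \<open>
  Otherwise the product of elements chosen from each \<open>Q - I\<close> would lie in the intersection but not in
  \<open>I\<close>. For the empty family that product is the unit.
\<close>

lemma (in primeideal) contains_member_of_finite_intersection: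
  assumes "finite Qs" "\<And>Q. Q \<in> Qs \<Longrightarrow> ideal Q R" "carrier R \<inter> \<Inter>Qs \<subseteq> I"
  shows "\<exists>Q\<in>Qs. Q \<subseteq> I"
proof (rule ccontr)
  assume none: "\<not> (\<exists>Q\<in>Qs. Q \<subseteq> I)"
  have "\<exists>x. x \<in> carrier R \<inter> \<Inter>Qs \<and> x \<notin> I"
    using assms(1,2) none
  proof (induction Qs rule: finite_induct)
    case empty
    have "\<one> \<notin> I" using one_imp_carrier I_notcarr by auto
    then show ?case by auto
  next
    case (insert Q Qs)
    then obtain x where x: "x \<in> carrier R \<inter> \<Inter>Qs" "x \<notin> I" by auto
    obtain y where y: "y \<in> Q" "y \<notin> I" using insert.prems by auto
    interpret Q: ideal Q R using insert.prems by simp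
    have yc: "y \<in> carrier R" using y Q.Icarr by simp
    have "x \<otimes> y \<in> carrier R \<inter> \<Inter>(insert Q Qs)"
      using x y yc Q.I_l_closed insert.prems(1) by (auto intro: ideal.I_r_closed)
    moreover have "x \<otimes> y \<notin> I" using I_prime[of x y] x y yc by auto
    ultimately show ?case by blast
  qed
  then show False using assms(3) by blast
qed

lemma (in primeideal) mem_if_pow_mem:
  assumes "a \<in> carrier R" "a [^] (k::nat) \<in> I"
  shows "a \<in> I"
  using assms(2)
proof (induction k)
  case 0
  then show ?case using one_imp_carrier I_notcarr by auto
next
  case (Suc k)
  then show ?case using I_prime[of "a [^] k" a] assms(1) by auto
qed

lemma primeideal_radical:
  assumes "primeideal P R"
  shows "radical R P = P"
proof -
  interpret primeideal P R by (rule assms)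
  have "a [^]\<^bsub>R\<^esub> (1::nat) \<in> P" if "a \<in> P" for a using that Icarr by simp
  then show ?thesis unfolding radical_def using mem_if_pow_mem Icarr by blast
qed

lemma primeideal_primary_ideal:
  assumes "primeideal P R"
  shows "primary_ideal R P"
proof -
  interpret primeideal P R by (rule assms)
  have "b [^]\<^bsub>R\<^esub> (1::nat) = b" if "b \<in> carrier R" for b using that by simp
  then show ?thesis
    unfolding primary_ideal_def using I_prime I_notcarr is_ideal by metis
qed

text \<open>
  An irredundant decomposition into primes is unique: given two of them, each prime \<open>P\<close> of one
  contains a prime \<open>Q\<close> of the other, which contains a prime \<open>P'\<close> of the first; irredundancy forces
  \<open>P' = P\<close> and so \<open>P = Q\<close>.
\<close>

lemma prime_components_eq:
  assumes fin: "finite Ps" and prime: "\<And>P. P \<in> Ps \<Longrightarrow> primeideal P R"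
    and L: "L = carrier R \<inter> \<Inter>Ps"
    and irr: "\<And>P. P \<in> Ps \<Longrightarrow> \<not> carrier R \<inter> \<Inter>(Ps - {P}) \<subseteq> P"
  shows "prime_components R L = Ps"
  unfolding prime_components_def
proof (rule the_equality)
  show "minimal_primary_decomposition R L Ps \<and> (\<forall>P\<in>Ps. primeideal P R)"
    unfolding minimal_primary_decomposition_def
    using assms by (auto intro!: inj_onI simp: primeideal_primary_ideal primeideal_radical)
next
  fix Qs assume "minimal_primary_decomposition R L Qs \<and> (\<forall>P\<in>Qs. primeideal P R)"
  then have Qs: "finite Qs" "\<And>Q. Q \<in> Qs \<Longrightarrow> primeideal Q R" "L = carrier R \<inter> \<Inter>Qs"
    "\<And>Q. Q \<in> Qs \<Longrightarrow> \<not> carrier R \<inter> \<Inter>(Qs - {Q}) \<subseteq> Q"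
    unfolding minimal_primary_decomposition_def by auto
  have half: "As \<subseteq> Bs"
    if A: "finite As" "\<And>P. P \<in> As \<Longrightarrow> primeideal P R" "L = carrier R \<inter> \<Inter>As"
        "\<And>P. P \<in> As \<Longrightarrow> \<not> carrier R \<inter> \<Inter>(As - {P}) \<subseteq> P"
      and B: "finite Bs" "\<And>P. P \<in> Bs \<Longrightarrow> primeideal P R" "L = carrier R \<inter> \<Inter>Bs" for As Bs
  proof
    fix P assume P: "P \<in> As"
    have "carrier R \<inter> \<Inter>Bs \<subseteq> P" using P A(3) B(3) by blast
    then obtain Q where Q: "Q \<in> Bs" "Q \<subseteq> P"
      using primeideal.contains_member_of_finite_intersection[OF A(2)[OF P] B(1)]
        B(2) primeideal.axioms(1) by blast
    have "carrier R \<inter> \<Inter>As \<subseteq> Q" using Q A(3) B(3) by blast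
    then obtain P' where P': "P' \<in> As" "P' \<subseteq> Q"
      using primeideal.contains_member_of_finite_intersection[OF B(2)[OF Q(1)] A(1)]
        A(2) primeideal.axioms(1) by blast
    have "P' = P" using A(4)[OF P] P' Q(2) by blast
    then show "P \<in> Bs" using P' Q by auto
  qed
  show "Qs = Ps"
    using half[OF Qs fin prime L] half[OF fin prime L irr Qs(1-3)] by blast
qed

section \<open>Symbolic powers of square-free monomial ideals\<close>

definition minimal_members :: "'b set set \<Rightarrow> 'b set set" where
  "minimal_members \<F> = {F \<in> \<F>. \<forall>F'\<in>\<F>. F' \<subseteq> F \<longrightarrow> F' = F}"

lemma minimal_member_below:
  assumes "F \<in> \<F>" "finite F"
  shows "\<exists>F'\<in>minimal_members \<F>. F' \<subseteq> F"
  using assms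
proof (induction "card F" arbitrary: F rule: less_induct)
  case less
  show ?case
  proof (cases "F \<in> minimal_members \<F>")
    case False
    then obtain F' where F': "F' \<in> \<F>" "F' \<subset> F"
      using less.prems(1) by (auto simp: minimal_members_def)
    then obtain F'' where "F'' \<in> minimal_members \<F>" "F'' \<subseteq> F'"
      using less.hyps[of F'] psubset_card_mono[OF less.prems(2)] finite_subset less.prems(2) by blast
    then show ?thesis using F'(2) by blast
  qed blast
qed

lemma weight_mono: "\<lbrakk>F' \<subseteq> F; finite F\<rbrakk> \<Longrightarrow> weight F' u \<le> weight F u"
  unfolding weight_def by (rule sum_mono2) auto

lemma weight_minimal_members_iff:
  assumes "\<F> \<subseteq> Pow {1..n}"
  shows "(\<forall>F\<in>minimal_members \<F>. q \<le> weight F u) \<longleftrightarrow> (\<forall>F\<in>\<F>. q \<le> weight F u)"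
proof
  assume *: "\<forall>F\<in>minimal_members \<F>. q \<le> weight F u"
  show "\<forall>F\<in>\<F>. q \<le> weight F u"
  proof
    fix F assume F: "F \<in> \<F>"
    then have "finite F" using assms finite_subset by blast
    then show "q \<le> weight F u"
      using minimal_member_below[OF F] weight_mono * order_trans by meson
  qed
qed (auto simp: minimal_members_def)

text \<open>
  The monomials of the ideal are those whose support is a transversal of \<open>\<F>\<close>, and for
  these only the minimal members of \<open>\<F>\<close> matter. No minimal member \<open>F\<close> can be dropped: the product of all variables outside \<open>F\<close> meets every
  other minimal member but not \<open>F\<close>.
\<close>

lemma prime_components_covers:
  assumes \<F>: "\<F> \<subseteq> Pow {1..n}"
  shows "prime_components (poly_ring n) (mon_ideal n {u. \<forall>F\<in>\<F>. 1 \<le> weight F u} :: ('a::field) mpoly set) =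
         (\<lambda>F. mon_ideal n {u. 1 \<le> weight F u}) ` minimal_members \<F>"
proof -
  let ?R = "poly_ring n :: 'a mpoly ring"
  let ?P = "\<lambda>F. mon_ideal n {u. 1 \<le> weight F u} :: 'a mpoly set"
  let ?M = "minimal_members \<F>"
  have M: "?M \<subseteq> Pow {1..n}" using \<F> by (auto simp: minimal_members_def)
  show ?thesis
  proof (rule prime_components_eq)
    show "finite (?P ` ?M)" using M finite_subset by blast
    show "primeideal P ?R" if "P \<in> ?P ` ?M" for P
      using that variables_ideal_prime by blast
    have "mon_ideal n {u. \<forall>F\<in>\<F>. 1 \<le> weight F u} = mon_ideal n {u. \<forall>F\<in>?M. 1 \<le> weight F u}"
      by (simp only: weight_minimal_members_iff[OF \<F>])
    also have "\<dots> = carrier ?R \<inter> \<Inter>(?P ` ?M)"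
      by (auto simp: mon_ideal_def carrier_poly_ring)
    finally show "mon_ideal n {u. \<forall>F\<in>\<F>. 1 \<le> weight F u} = carrier ?R \<inter> \<Inter>(?P ` ?M)" .
    show "\<not> carrier ?R \<inter> \<Inter>(?P ` ?M - {P}) \<subseteq> P" if P: "P \<in> ?P ` ?M" for P
    proof -
      obtain F where F: "F \<in> ?M" "P = ?P F" using P by blast
      define u where "u = (\<Sum>v\<in>{1..n} - F. Poly_Mapping.single v (1::nat))"
      have weight_u: "weight F' u = card (F' - F)" if "F' \<subseteq> {1..n}" for F'
      proof -
        have "finite F'" using that finite_subset by blast
        then have "weight F' u = card (({1..n} - F) \<inter> F')"
          by (simp add: u_def weight_sum weight_single sum.inter_restrict[symmetric])
        also have "({1..n} - F) \<inter> F' = F' - F" using that by auto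
        finally show ?thesis .
      qed
      have keys_u: "Poly_Mapping.keys u \<subseteq> {1..n}"
        by (auto simp: u_def in_keys_iff lookup_sum lookup_single when_def split: if_splits)
      have "monom_poly u \<notin> ?P F"
        using weight_u[of F] F M by (auto simp: monom_poly_in_mon_ideal_iff)
      moreover have "monom_poly u \<in> ?P F'" if F': "F' \<in> ?M" "?P F' \<noteq> ?P F" for F'
      proof -
        have "\<not> F' \<subseteq> F" using F' F(1) by (auto simp: minimal_members_def)
        moreover have "finite F'" "F' \<subseteq> {1..n}" using F' M finite_subset by blast+
        ultimately have "1 \<le> weight F' u"
          using weight_u[of F'] by (simp add: Suc_le_eq card_gt_0_iff)
        then show ?thesis using keys_u by (simp add: monom_poly_in_mon_ideal_iff)
      qed
      moreover have "monom_poly u \<in> carrier ?R"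
        using keys_u by (simp add: carrier_poly_ring monom_poly_in_mon_ideal_iff)
      ultimately show ?thesis using F by blast
    qed
  qed
qed

lemma symbolic_power_covers:
  assumes \<F>: "\<F> \<subseteq> Pow {1..n}"
  shows "symbolic_power (poly_ring n) (mon_ideal n {u. \<forall>F\<in>\<F>. 1 \<le> weight F u}) q =
         (mon_ideal n {u. \<forall>F\<in>\<F>. q \<le> weight F u} :: ('a::field) mpoly set)"
proof -
  let ?M = "minimal_members \<F>"
  have "mon_ideal n {u. 1 \<le> weight F u} [^]\<^bsub>ideals_set (poly_ring n)\<^esub> q =
         (mon_ideal n {u. q \<le> weight F u} :: 'a mpoly set)" if "F \<in> ?M" for F
    using that \<F> by (intro variables_ideal_power) (auto simp: minimal_members_def)
  then have "symbolic_power (poly_ring n) (mon_ideal n {u. \<forall>F\<in>\<F>. 1 \<le> weight F u}) q =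
      carrier (poly_ring n :: 'a mpoly ring) \<inter> (\<Inter>F\<in>?M. mon_ideal n {u. q \<le> weight F u})"
    unfolding symbolic_power_def prime_components_covers[OF \<F>] by simp
  also have "\<dots> = mon_ideal n {u. \<forall>F\<in>?M. q \<le> weight F u}"
    by (auto simp: mon_ideal_def carrier_poly_ring)
  finally show ?thesis by (simp only: weight_minimal_members_iff[OF \<F>])
qed

lemma monom_degree_eq_weight:
  assumes "Poly_Mapping.keys u \<subseteq> {1..n}"
  shows "monom_degree u = weight {1..n} u"
  unfolding monom_degree_def weight_def
  by (rule sum.mono_neutral_left) (use assms in \<open>auto simp: in_keys_iff\<close>)

text \<open>
  The monomials of the ideal generate it, which bounds \<open>alpha\<close> from above. Conversely every monomial
  of a generator is a monomial of the ideal, so no homogeneous generator has smaller degree.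
\<close>

lemma alpha_mon_ideal:
  fixes U :: "monom set"
  assumes up: "\<And>u w. u \<in> U \<Longrightarrow> u + w \<in> U"
    and ne: "u0 \<in> U" "Poly_Mapping.keys u0 \<subseteq> {1..n}"
  shows "alpha n (mon_ideal n U :: ('a::field) mpoly set) =
         (LEAST d. \<exists>u\<in>U. Poly_Mapping.keys u \<subseteq> {1..n} \<and> weight {1..n} u = d)"
    (is "_ = (LEAST d. ?D d)")
  unfolding alpha_def
proof (rule Least_equality)
  let ?J = "mon_ideal n U :: 'a mpoly set"
  let ?R = "poly_ring n :: 'a mpoly ring"
  define d where "d = (LEAST d. ?D d)"
  define S where "S = {u \<in> U. Poly_Mapping.keys u \<subseteq> {1..n}}"
  have "?D d" unfolding d_def by (rule LeastI_ex) (use ne in blast)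
  then obtain u where u: "u \<in> S" "monom_degree u = d"
    by (auto simp: S_def monom_degree_eq_weight)
  have gen: "Idl\<^bsub>?R\<^esub> (monom_poly ` S) = ?J"
  proof -
    have "Idl\<^bsub>?R\<^esub> (monom_poly ` S) = mon_ideal n {g + w | g w. g \<in> S}"
      by (rule genideal_monomials) (simp add: S_def)
    also have "\<dots> = ?J"
    proof (rule mon_ideal_cong)
      fix x :: monom assume "Poly_Mapping.keys x \<subseteq> {1..n}"
      then have "x \<in> S" if "x \<in> U" using that by (simp add: S_def)
      moreover have "x = x + 0" by simp
      ultimately show "x \<in> {g + w | g w. g \<in> S} \<longleftrightarrow> x \<in> U"
        using up unfolding S_def by blast
    qed
    finally show ?thesis .
  qed
  have hom: "homogeneous_of_degree (monom_degree v) (monom_poly v :: 'a mpoly)" for v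
    by (simp add: homogeneous_of_degree_def monom_poly_def)
  show "\<exists>G\<subseteq>carrier ?R. (\<forall>g\<in>G. g \<noteq> 0 \<and> (\<exists>e. homogeneous_of_degree e g)) \<and>
      Idl\<^bsub>?R\<^esub> G = ?J \<and> (\<exists>g\<in>G. homogeneous_of_degree (LEAST d. ?D d) g)"
  proof (intro exI[of _ "monom_poly ` S"] conjI ballI)
    show "monom_poly ` S \<subseteq> carrier ?R"
      by (auto simp: S_def carrier_poly_ring monom_poly_in_mon_ideal_iff)
    show "g \<noteq> 0" "\<exists>e. homogeneous_of_degree e g" if "g \<in> monom_poly ` S" for g :: "'a mpoly"
      using that hom by (auto simp: monom_poly_def) (metis lookup_single_eq lookup_zero zero_neq_one)
    show "\<exists>g\<in>monom_poly ` S. homogeneous_of_degree (LEAST d. ?D d) (g :: 'a mpoly)"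
      using u hom[of u] unfolding d_def by auto
  qed (rule gen)
  fix e
  assume "\<exists>G\<subseteq>carrier ?R. (\<forall>g\<in>G. g \<noteq> 0 \<and> (\<exists>e. homogeneous_of_degree e g)) \<and>
      Idl\<^bsub>?R\<^esub> G = ?J \<and> (\<exists>g\<in>G. homogeneous_of_degree e g)"
  then obtain G g where G: "G \<subseteq> carrier ?R" "Idl\<^bsub>?R\<^esub> G = ?J" "g \<in> G" "g \<noteq> 0" "homogeneous_of_degree e g"
    by blast
  have "g \<in> ?J" using ring.genideal_self[OF poly_ring_ring G(1)] G(2,3) by blast
  moreover obtain x where x: "x \<in> Poly_Mapping.keys g" using G(4) by fastforce
  ultimately have "x \<in> U" "Poly_Mapping.keys x \<subseteq> {1..n}" by (auto simp: mon_ideal_def)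
  moreover have "monom_degree x = e" using G(5) x by (simp add: homogeneous_of_degree_def)
  ultimately show "(LEAST d. ?D d) \<le> e"
    by (intro Least_le) (auto simp: monom_degree_eq_weight)
qed

text \<open>
  The initial degree of the symbolic power in combinatorial terms: the optimum of the integer program
  that asks for nonnegative integer weights on the variables with total at least \<open>q\<close> on each member
  of \<open>\<F>\<close>.
\<close>

definition cover_degree :: "nat \<Rightarrow> nat set set \<Rightarrow> nat \<Rightarrow> nat" where
  "cover_degree n \<F> q =
     (LEAST d. \<exists>u. (\<forall>F\<in>\<F>. q \<le> weight F u) \<and> Poly_Mapping.keys u \<subseteq> {1..n} \<and> weight {1..n} u = d)"

lemma cover_exists:
  assumes "\<F> \<subseteq> Pow {1..n}" "{} \<notin> \<F>"
  shows "\<exists>u. (\<forall>F\<in>\<F>. q \<le> weight F u) \<and> Poly_Mapping.keys u \<subseteq> {1..n}"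
proof (intro exI conjI ballI)
  let ?u = "\<Sum>v\<in>{1..n}. Poly_Mapping.single v q"
  have look: "Poly_Mapping.lookup ?u v = (if v \<in> {1..n} then q else 0)" for v
    by (simp add: lookup_sum lookup_single when_def)
  then show "Poly_Mapping.keys ?u \<subseteq> {1..n}" by (auto simp: in_keys_iff split: if_splits)
  fix F assume F: "F \<in> \<F>"
  then obtain v where v: "v \<in> F" using assms(2) by (metis ex_in_conv)
  have "finite F" using F assms(1) finite_subset by blast
  then have "Poly_Mapping.lookup ?u v \<le> weight F ?u"
    unfolding weight_def using v by (intro member_le_sum) auto
  moreover have "v \<in> {1..n}" using v F assms(1) by blast
  ultimately show "q \<le> weight F ?u" using look by simp
qed

lemma cover_degree_attained:
  assumes "\<F> \<subseteq> Pow {1..n}" "{} \<notin> \<F>"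
  obtains u where "\<And>F. F \<in> \<F> \<Longrightarrow> q \<le> weight F u" "Poly_Mapping.keys u \<subseteq> {1..n}"
    "weight {1..n} u = cover_degree n \<F> q"
proof -
  have "\<exists>d u. (\<forall>F\<in>\<F>. q \<le> weight F u) \<and> Poly_Mapping.keys u \<subseteq> {1..n} \<and> weight {1..n} u = d"
    using cover_exists[OF assms] by blast
  from LeastI_ex[OF this] show thesis using that unfolding cover_degree_def by blast
qed

lemma alpha_symbolic_power_covers:
  assumes "\<F> \<subseteq> Pow {1..n}" "{} \<notin> \<F>"
  shows "alpha n (symbolic_power (poly_ring n)
           (mon_ideal n {u. \<forall>F\<in>\<F>. 1 \<le> weight F u} :: ('a::field) mpoly set) q) = cover_degree n \<F> q"
proof -
  obtain u where u: "\<forall>F\<in>\<F>. q \<le> weight F u" "Poly_Mapping.keys u \<subseteq> {1..n}"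
    using cover_exists[OF assms] by blast
  show ?thesis
    unfolding symbolic_power_covers[OF assms(1)] cover_degree_def
    by (subst alpha_mon_ideal[of _ u]) (use u in \<open>auto simp: weight_add trans_le_add1\<close>)
qed

lemma cover_degree_subadditive:
  assumes "\<F> \<subseteq> Pow {1..n}" "{} \<notin> \<F>"
  shows "cover_degree n \<F> (p + q) \<le> cover_degree n \<F> p + cover_degree n \<F> q"
proof -
  obtain u where u: "\<And>F. F \<in> \<F> \<Longrightarrow> p \<le> weight F u" "Poly_Mapping.keys u \<subseteq> {1..n}"
    "weight {1..n} u = cover_degree n \<F> p" using cover_degree_attained[OF assms] by blast
  obtain w where w: "\<And>F. F \<in> \<F> \<Longrightarrow> q \<le> weight F w" "Poly_Mapping.keys w \<subseteq> {1..n}"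
    "weight {1..n} w = cover_degree n \<F> q" using cover_degree_attained[OF assms] by blast
  have "cover_degree n \<F> (p + q) \<le> weight {1..n} (u + w)"
    unfolding cover_degree_def[of n \<F> "p + q"]
    by (intro Least_le exI[of _ "u + w"])
      (use u w in \<open>auto simp: weight_add keys_add_monom add_mono\<close>)
  then show ?thesis using u(3) w(3) by (simp add: weight_add)
qed

text \<open>
  The constant is a \<open>lim\<close>, which is meaningful only together with convergence; hence the detour
  through subadditivity before the bound can be passed to the limit.
\<close>

lemma waldschmidt_ge_if_covers_ge:
  assumes \<F>: "\<F> \<subseteq> Pow {1..n}" "{} \<notin> \<F>"
    and ge: "\<And>q u. (\<And>F. F \<in> \<F> \<Longrightarrow> q \<le> weight F u) \<Longrightarrow> real q * B \<le> real (weight {1..n} u)"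
  shows "waldschmidt n (mon_ideal n {u. \<forall>F\<in>\<F>. 1 \<le> weight F u} :: ('a::field) mpoly set) \<ge> B"
proof -
  let ?a = "\<lambda>q. real (cover_degree n \<F> q) / real q"
  have "convergent ?a"
    by (rule subadditive_nat_convergent) (rule cover_degree_subadditive[OF \<F>])
  then have "?a \<longlonglongrightarrow> lim ?a" by (simp add: convergent_LIMSEQ_iff)
  moreover have "B \<le> ?a q" if "1 \<le> q" for q
  proof -
    obtain u where "\<And>F. F \<in> \<F> \<Longrightarrow> q \<le> weight F u" "weight {1..n} u = cover_degree n \<F> q"
      using cover_degree_attained[OF \<F>] by metis
    then have "real q * B \<le> real (cover_degree n \<F> q)" using ge[of q u] by simp
    then show ?thesis using that by (simp add: field_simps)
  qed
  ultimately have "B \<le> lim ?a" by (intro LIMSEQ_le_const) auto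
  then show ?thesis unfolding waldschmidt_def alpha_symbolic_power_covers[OF \<F>] .
qed

section \<open>The square-free Borel ideal as a cover ideal\<close>

text \<open>
  A square-free monomial with support \<open>U\<close> lies in the Borel ideal iff \<open>card (U \<inter> {1..i p}) \<ge> p\<close> for every \<open>p\<close>,
  in other words iff \<open>U\<close> cannot avoid \<open>i p - p + 1\<close> of the first \<open>i p\<close> variables. The sets that must
  not be avoided are collected here; different \<open>p\<close> may yield comparable sets.
\<close>

definition window_sets :: "(nat \<Rightarrow> nat) \<Rightarrow> nat \<Rightarrow> nat set set" where
  "window_sets i s = {F. \<exists>p\<in>{1..s}. F \<subseteq> {1..i p} \<and> card F = i p - p + 1}"

lemma borel_move_weight_prefix:
  assumes "borel_move m u"
  shows "weight {1..e} m \<le> weight {1..e} u"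
proof -
  obtain ps where ps: "\<forall>(a, b)\<in>set ps. 1 \<le> a \<and> a < b \<and> b \<in> Poly_Mapping.keys m"
    and eq: "u + (\<Sum>(a, b)\<leftarrow>ps. Poly_Mapping.single b 1) = m + (\<Sum>(a, b)\<leftarrow>ps. Poly_Mapping.single a 1)"
    using assms by (auto simp: borel_move_def)
  have "weight {1..e} (\<Sum>(a, b)\<leftarrow>ps. Poly_Mapping.single b 1) \<le>
        weight {1..e} (\<Sum>(a, b)\<leftarrow>ps. Poly_Mapping.single a 1)"
    using ps by (induction ps) (auto simp: weight_add weight_single)
  then show ?thesis
    using arg_cong[OF eq, of "weight {1..e}"] by (simp add: weight_add)
qed

lemma borel_move_keys:
  assumes "borel_move m u" "Poly_Mapping.keys m \<subseteq> {1..n}"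
  shows "Poly_Mapping.keys u \<subseteq> {1..n}"
proof -
  obtain ps where ps: "\<forall>(a, b)\<in>set ps. 1 \<le> a \<and> a < b \<and> b \<in> Poly_Mapping.keys m"
    and eq: "u + (\<Sum>(a, b)\<leftarrow>ps. Poly_Mapping.single b 1) = m + (\<Sum>(a, b)\<leftarrow>ps. Poly_Mapping.single a 1)"
    using assms(1) by (auto simp: borel_move_def)
  have "Poly_Mapping.keys (\<Sum>(a, b)\<leftarrow>ps. Poly_Mapping.single a (1::nat)) \<subseteq> {1..n}"
    using ps
  proof (induction ps)
    case (Cons ab ps)
    then show ?case using assms(2) by (cases ab) (force simp: keys_add_monom)
  qed simp
  then show ?thesis
    using arg_cong[OF eq, of Poly_Mapping.keys] assms(2) by (auto simp: keys_add_monom)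
qed

text \<open>
  The move replaces \<open>i p\<close> by \<open>j p\<close> for those \<open>p\<close> with \<open>j p < i p\<close>; for the others nothing happens.
\<close>

lemma borel_move_product:
  fixes i j :: "nat \<Rightarrow> nat" and s :: nat
  assumes m: "m = (\<Sum>p\<in>{1..s}. Poly_Mapping.single (i p) 1)"
    and j: "\<And>p. p \<in> {1..s} \<Longrightarrow> 1 \<le> j p \<and> j p \<le> i p"
  shows "borel_move m (\<Sum>p\<in>{1..s}. Poly_Mapping.single (j p) 1)"
proof -
  have keys: "i p \<in> Poly_Mapping.keys m" if "p \<in> {1..s}" for p
  proof -
    have "Poly_Mapping.lookup (Poly_Mapping.single (i p) (1::nat)) (i p) \<le> Poly_Mapping.lookup m (i p)"
      unfolding m lookup_sum using that
      by (intro member_le_sum[of p "{1..s}" "\<lambda>x. Poly_Mapping.lookup (Poly_Mapping.single (i x) 1) (i p)"]) auto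
    then show ?thesis by (simp add: in_keys_iff)
  qed
  have list: "(\<Sum>p\<leftarrow>L. Poly_Mapping.single (j p) 1) +
      (\<Sum>(a, b)\<leftarrow>map (\<lambda>p. (j p, i p)) (filter (\<lambda>p. j p < i p) L). Poly_Mapping.single b 1) =
      (\<Sum>p\<leftarrow>L. Poly_Mapping.single (i p) 1) +
      (\<Sum>(a, b)\<leftarrow>map (\<lambda>p. (j p, i p)) (filter (\<lambda>p. j p < i p) L). Poly_Mapping.single a (1::nat))"
    if "\<And>p. p \<in> set L \<Longrightarrow> j p \<le> i p" for L
    using that
  proof (induction L)
    case (Cons p L)
    then have "j p = i p" if "\<not> j p < i p" using that by force
    with Cons show ?case by (auto simp: add_ac)
  qed simp
  have sum: "(\<Sum>p\<in>{1..s}. f p) = (\<Sum>p\<leftarrow>[1..<s+1]. f p)" for f :: "nat \<Rightarrow> monom"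
    by (subst sum_list_distinct_conv_sum_set) (auto intro: sum.cong)
  show ?thesis
    unfolding borel_move_def
  proof (intro exI conjI)
    show "\<forall>(a, b)\<in>set (map (\<lambda>p. (j p, i p)) (filter (\<lambda>p. j p < i p) [1..<s+1])).
        1 \<le> a \<and> a < b \<and> b \<in> Poly_Mapping.keys m"
      using j keys by auto
  qed (unfold m sum, rule list, use j in auto)
qed

text \<open>
  A Borel move never lowers the number of variables with index at most \<open>i p\<close>, which is \<open>p\<close> for \<open>m\<close>, so
  a square-free one cannot avoid a set of \<open>i p - p + 1\<close> of them. Conversely, if the support of \<open>u\<close> meets all
  these sets, then it has at least \<open>p\<close> elements up to \<open>i p\<close>; its \<open>s\<close> smallest elements \<open>j 1\<close>, \<dots>, \<open>j s\<close>
  then satisfy \<open>j p \<le> i p\<close> and form a square-free Borel move that divides \<open>u\<close>.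
\<close>

lemma sfBorel_eq_covers:
  assumes i_mono: "strict_mono_on {1..s} i"
    and i_range: "i ` {1..s} \<subseteq> {1..n}"
    and i_ge: "\<And>p. p \<in> {1..s} \<Longrightarrow> p \<le> i p"
    and m: "m = (\<Sum>p\<in>{1..s}. Poly_Mapping.single (i p) 1)"
  shows "(sfBorel n m :: ('a::field) mpoly set) = mon_ideal n {u. \<forall>F\<in>window_sets i s. 1 \<le> weight F u}"
proof -
  let ?G = "{u. squarefree_monom u \<and> borel_move m u}"
  have keys_m: "Poly_Mapping.keys m \<subseteq> {1..n}"
    using i_range unfolding m by (fastforce simp: in_keys_iff lookup_sum lookup_single when_def split: if_splits)
  have "(sfBorel n m :: 'a mpoly set) = mon_ideal n {g + w | g w. g \<in> ?G}"
    unfolding sfBorel_def by (rule genideal_monomials) (use borel_move_keys[OF _ keys_m] in blast)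
  also have "\<dots> = mon_ideal n {u. \<forall>F\<in>window_sets i s. 1 \<le> weight F u}"
  proof (rule mon_ideal_cong, unfold mem_Collect_eq, rule iffI)
    fix u assume "\<exists>g w. u = g + w \<and> squarefree_monom g \<and> borel_move m g"
    then obtain g w where u: "u = g + w" and sqf: "squarefree_monom g" and move: "borel_move m g"
      by blast
    show "\<forall>F\<in>window_sets i s. 1 \<le> weight F u"
    proof (rule ballI, rule ccontr)
      fix F assume "F \<in> window_sets i s" and zero: "\<not> 1 \<le> weight F u"
      then obtain p where p: "p \<in> {1..s}" "F \<subseteq> {1..i p}" "card F = i p - p + 1"
        by (auto simp: window_sets_def)
      have fin: "finite F" using p(2) finite_subset by blast
      have "p = card {1..p}" by simp
      also have "\<dots> \<le> card {x \<in> {1..s}. i x \<in> {1..i p}}"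
      proof (rule card_mono)
        have "1 \<le> i x \<and> i x \<le> i p" if "x \<in> {1..p}" for x
          using that p(1) i_range strict_mono_on_leD[OF i_mono, of x p] by fastforce
        then show "{1..p} \<subseteq> {x \<in> {1..s}. i x \<in> {1..i p}}" using p(1) by auto
      qed simp
      also have "\<dots> = weight {1..i p} m"
        by (simp add: m weight_sum weight_single sum.inter_filter[symmetric] del: atLeastAtMost_iff)
      also have "\<dots> \<le> weight {1..i p} g" by (rule borel_move_weight_prefix[OF move])
      also have "\<dots> = weight ({1..i p} - F) g + weight F g"
        unfolding weight_def using p(2) by (intro sum.subset_diff) auto
      also have "weight F g = 0" using zero by (simp add: u weight_add)
      also have "weight ({1..i p} - F) g \<le> card ({1..i p} - F)"
        unfolding weight_def using sqf sum_bounded_above[of "{1..i p} - F" "Poly_Mapping.lookup g" 1]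
        by (simp add: squarefree_monom_def)
      also have "card ({1..i p} - F) = i p - card F"
        using card_Diff_subset[OF fin p(2)] by simp
      finally show False using p(1,3) i_ge[OF p(1)] by auto
    qed
  next
    fix u :: monom assume keys_u: "Poly_Mapping.keys u \<subseteq> {1..n}"
      and cover: "\<forall>F\<in>window_sets i s. 1 \<le> weight F u"
    let ?W = "Poly_Mapping.keys u"
    have count: "p \<le> card (?W \<inter> {1..i p})" if p: "p \<in> {1..s}" for p
    proof (rule ccontr)
      assume "\<not> p \<le> card (?W \<inter> {1..i p})"
      then have "i p - p + 1 \<le> card ({1..i p} - ?W)"
        using i_ge[OF p] by (simp add: card_Diff_subset_Int Int_commute)
      then obtain F where F: "F \<subseteq> {1..i p} - ?W" "card F = i p - p + 1"
        by (meson obtain_subset_with_card_n)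
      then have "F \<in> window_sets i s" using p by (auto simp: window_sets_def)
      then have "1 \<le> weight F u" using cover by blast
      moreover have "weight F u = 0"
        unfolding weight_def by (rule sum.neutral) (use F(1) in \<open>auto simp: in_keys_iff\<close>)
      ultimately show False by simp
    qed
    define xs where "xs = sorted_list_of_set ?W"
    define j where "j p = xs ! (p - 1)" for p
    have xs: "set xs = ?W" "length xs = card ?W" "sorted xs" "distinct xs"
      by (simp_all add: xs_def)
    have len: "p \<le> length xs" if "p \<in> {1..s}" for p
      using count[OF that] card_mono[of ?W "?W \<inter> {1..i p}"] xs(2) by simp
    have j_mem: "j p \<in> ?W" if "p \<in> {1..s}" for p
    proof -
      have "p - 1 < length xs" using len[OF that] that by auto
      then show ?thesis using nth_mem xs(1) unfolding j_def by blast
    qed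
    have j_le: "j p \<le> i p" if p: "p \<in> {1..s}" for p
    proof (rule ccontr)
      assume less: "\<not> j p \<le> i p"
      have "?W \<inter> {1..i p} \<subseteq> (!) xs ` {..<p - 1}"
      proof
        fix x assume x: "x \<in> ?W \<inter> {1..i p}"
        then obtain k where k: "k < length xs" "x = xs ! k"
          using xs(1) by (metis IntD1 in_set_conv_nth)
        have "k < p - 1"
        proof (rule ccontr)
          assume "\<not> k < p - 1"
          then have "j p \<le> x"
            using k xs(3) sorted_nth_mono[of xs "p - 1" k] unfolding j_def
            by simp
          then show False using less x by simp
        qed
        then show "x \<in> (!) xs ` {..<p - 1}" using k by blast
      qed
      then have "card (?W \<inter> {1..i p}) \<le> card ((!) xs ` {..<p - 1})" by (intro card_mono) auto
      also have "\<dots> \<le> p - 1" using card_image_le[of "{..<p - 1}" "(!) xs"] by simp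
      finally show False using count[OF p] p by auto
    qed
    have inj: "inj_on j {1..s}"
    proof (rule inj_onI)
      fix p q assume pq: "p \<in> {1..s}" "q \<in> {1..s}" "j p = j q"
      then have "p - 1 = q - 1"
        using len[of p] len[of q] xs(4) nth_eq_iff_index_eq[of xs "p - 1" "q - 1"]
        unfolding j_def by auto
      then show "p = q" using pq by auto
    qed
    define g where "g = (\<Sum>p\<in>{1..s}. Poly_Mapping.single (j p) (1::nat))"
    have look: "Poly_Mapping.lookup g v = (if v \<in> j ` {1..s} then 1 else 0)" for v
    proof -
      have "Poly_Mapping.lookup g v = (\<Sum>x\<in>j ` {1..s}. Poly_Mapping.lookup (Poly_Mapping.single x 1) v)"
        unfolding g_def lookup_sum sum.reindex[OF inj] by (simp only: o_def)
      then show ?thesis by (simp add: lookup_single when_def)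
    qed
    have "squarefree_monom g" by (simp add: squarefree_monom_def look)
    moreover have "borel_move m g"
      unfolding g_def using m
      by (rule borel_move_product) (use j_mem j_le keys_u in fastforce)
    moreover have "u = g + (u - g)"
    proof (rule poly_mapping_eqI)
      fix v
      have "Poly_Mapping.lookup g v \<le> Poly_Mapping.lookup u v"
        using j_mem by (auto simp: look in_keys_iff Suc_le_eq)
      then show "Poly_Mapping.lookup u v = Poly_Mapping.lookup (g + (u - g)) v"
        by (simp add: lookup_add lookup_minus)
    qed
    ultimately show "\<exists>g w. u = g + w \<and> squarefree_monom g \<and> borel_move m g" by blast
  qed
  finally show ?thesis .
qed

section \<open>The lower bound\<close>

theorem theorem3p4:
  fixes n s k r l :: nat
    and i t tk :: "nat \<Rightarrow> nat"
    and m :: monom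
    and I :: "('a::field) mpoly set"
  assumes s: "1 \<le> s"
    and i_mono: "strict_mono_on {1..s} i"
    and i_range: "i ` {1..s} \<subseteq> {1..n}"
    and m: "m = (\<Sum>p\<in>{1..s}. Poly_Mapping.single (i p) 1)"
    and t: "t = T_elem i s" and k: "k = T_last i s"
    and less: "i (t k) < s"
    and tk: "tk = T'_desc i s" and r: "r = T'_length i s"
    and l: "l = Max {q \<in> {0..k}. i (tk 1) + 1 \<le> t q}"
    and I: "I = sfBorel n m"
  shows "waldschmidt n I \<ge>
     1 + (real s - real (i (tk 1)) - 1) / (real (i (t l)) - real (t l) + 1)
       + real (i (t k)) / (real (i (t k)) - real (t k) + 1)
       + (\<Sum>j = 1..r - 1. (real (i (tk j)) - real (i (tk (j + 1))))
                            / (real (i (tk j)) - real (tk j) + 1))"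
proof -
  have i_ge: "p \<le> i p" if "p \<in> {1..s}" for p
    using that
  proof (induction p)
    case (Suc p)
    show ?case
    proof (cases "p = 0")
      case True
      then show ?thesis using Suc.prems i_range by fastforce
    next
      case False
      then have "i p < i (Suc p)" using Suc.prems by (intro strict_mono_onD[OF i_mono]) auto
      then show ?thesis using Suc False by simp
    qed
  qed simp
  define \<rho> where "\<rho> = r - 1"
  define \<tau> where "\<tau> = T'_elem i s"
  have r_eq: "r = Suc \<rho>" by (simp add: \<rho>_def r T'_length_def)
  have tk_eq: "tk j = \<tau> (r - j)" for j by (simp add: tk T'_desc_def \<tau>_def r)
  have tk1: "tk 1 = \<tau> \<rho>" by (simp add: tk_eq r_eq)
  have tau0: "t k = \<tau> 0" by (simp add: \<tau>_def t k)
  have \<tau>_T: "\<tau> j \<in> T_set i s" if "j \<le> \<rho>" for j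
    using that unfolding \<tau>_def by (intro T'_elem_in_T_set) (simp add: r[symmetric] r_eq)
  have \<tau>_mem: "\<tau> j \<in> {1..s}" if "j \<le> \<rho>" for j using \<tau>_T[OF that] T_set_subset[OF s] by blast
  have chain: "\<tau> (Suc j) \<in> T'_candidates i s (\<tau> j)" if "j < \<rho>" for j
    using that unfolding \<tau>_def by (intro T'_elem_Suc_mem) (simp add: r[symmetric] r_eq)
  have last: "i (\<tau> \<rho>) < s"
  proof (cases \<rho>)
    case 0
    then show ?thesis using less tau0 by simp
  next
    case (Suc j)
    then show ?thesis using chain[of j] s by (auto simp: T'_candidates_def)
  qed
  have "l \<in> {q \<in> {0..k}. i (tk 1) + 1 \<le> t q}"
    unfolding l using last by (intro Max_in) (auto simp: tk1[simplified] t intro!: exI[of _ 0])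
  then have lk: "l \<le> k" and tl: "i (\<tau> \<rho>) < t l" by (auto simp: tk1[simplified])
  have tl_T: "t l \<in> T_set i s" using lk by (auto simp: T_set_def t k)
  have tl_mem: "t l \<in> {1..s}" using tl_T T_set_subset[OF s] by blast
  \<comment> \<open>Otherwise \<open>t l\<close> would be a candidate for continuing \<open>T'(m)\<close>.\<close>
  have tl_ge: "s \<le> i (t l)"
  proof (rule ccontr)
    assume "\<not> s \<le> i (t l)"
    then have "t l \<in> T'_candidates i s (\<tau> \<rho>)" using tl_T tl by (simp add: T'_candidates_def)
    moreover have "T'_candidates i s (\<tau> \<rho>) = {}"
      using T'_elem_exhausted[OF s i_ge] by (simp add: \<tau>_def \<rho>_def r)
    ultimately show False by simp
  qed
  \<comment> \<open>The sum of the claim runs along \<open>T'(m)\<close> downwards, \<open>\<tau>\<close> enumerates it upwards.\<close>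
  let ?f = "\<lambda>j. (real (i (\<tau> (Suc j))) - real (i (\<tau> j))) / (real (i (\<tau> (Suc j))) - real (\<tau> (Suc j)) + 1)"
  let ?B = "1 + (real s - real (i (\<tau> \<rho>)) - 1) / (real (i (t l)) - real (t l) + 1)
       + real (i (\<tau> 0)) / (real (i (\<tau> 0)) - real (\<tau> 0) + 1) + (\<Sum>j<\<rho>. ?f j)"
  have covers: "I = mon_ideal n {u. \<forall>F\<in>window_sets i s. 1 \<le> weight F u}"
    unfolding I by (rule sfBorel_eq_covers[OF i_mono i_range _ m]) (rule i_ge)
  have "waldschmidt n I \<ge> ?B"
    unfolding covers
  proof (rule waldschmidt_ge_if_covers_ge)
    have i_n: "i p \<le> n" if "p \<in> {1..s}" for p using that i_range by fastforce
    show "window_sets i s \<subseteq> Pow {1..n}"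
    proof
      fix F assume "F \<in> window_sets i s"
      then obtain p where "p \<in> {1..s}" "F \<subseteq> {1..i p}" by (auto simp: window_sets_def)
      then show "F \<in> Pow {1..n}" using i_n[of p] by fastforce
    qed
    show "{} \<notin> window_sets i s" by (simp add: window_sets_def)
    fix q u assume cover: "\<And>F. F \<in> window_sets i s \<Longrightarrow> q \<le> weight F u"
    have "real q * ?B \<le> (\<Sum>v=1..n. real (Poly_Mapping.lookup u v))"
    proof (rule covering_weight_ge)
      fix p F assume "p \<in> {1..s}" "F \<subseteq> {1..i p}" "card F = i p - p + 1"
      then have "q \<le> weight F u" by (intro cover) (auto simp: window_sets_def)
      then have "real q \<le> real (weight F u)" by simp
      then show "real q \<le> (\<Sum>v\<in>F. real (Poly_Mapping.lookup u v))" by (simp add: weight_def)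
    next
      show "i (\<tau> j) < \<tau> (Suc j)" if "j < \<rho>" for j using chain[OF that] by (simp add: T'_candidates_def)
    qed (use i_ge i_n \<tau>_mem last tl_mem tl tl_ge in auto)
    then show "real q * ?B \<le> real (weight {1..n} u)" by (simp add: weight_def)
  qed
  also have "(\<Sum>j<\<rho>. ?f j) = (\<Sum>j=1..r - 1. (real (i (tk j)) - real (i (tk (j + 1))))
                            / (real (i (tk j)) - real (tk j) + 1))"
    by (rule sum.reindex_bij_witness[where i = "\<lambda>j. \<rho> - j" and j = "\<lambda>j. \<rho> - j"])
      (auto simp: tk_eq r_eq Suc_diff_le)
  finally show ?thesis unfolding tk1 tau0 .
qed

end
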